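(* Let $\tau\in\mathbb{C}$ with $\operatorname{Im}(\tau)>0$ and $q=e^{2\pi i\tau}$. Then the following five identities hold: (1) $\displaystyle \eta(8\tau)^3=\sum_{n=1}^{\infty}\left(\frac{-4}{n}\right)n\,q^{n^2}$; (2) $\displaystyle \frac{\eta(16\tau)^9}{\eta(8\tau)^3\,\eta(32\tau)^3}=\sum_{n=1}^{\infty}\left(\frac{-2}{n}\right)n\,q^{n^2}$; (3) $\displaystyle \frac{\eta(3\tau)^2\,\eta(12\tau)^2}{\eta(6\tau)}=\sum_{n=1}^{\infty}\left(\frac{n}{3}\right)n\,q^{n^2}$; (4) $\displaystyle \frac{\eta(48\tau)^{13}}{\eta(24\tau)^5\,\eta(96\tau)^5}=\sum_{n=1}^{\infty}\left(\frac{-6}{n}\right)n\,q^{n^2}$; (5) $\displaystyle \frac{\eta(24\tau)^5}{\eta(48\tau)^2}=\sum_{n=1}^{\infty}\left(\frac{n}{12}\right)n\,q^{n^2}$.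
   Context: For $\operatorname{Im}(\tau)>0$ and $q=e^{2\pi i\tau}$, Dedekind's eta function is $\eta(\tau)=q^{1/24}\prod_{n=1}^{\infty}(1-q^n)$, where $q^{1/24}=e^{2\pi i\tau/24}$; $\eta(k\tau)^j$ denotes the $j$-th power of $\eta(k\tau)$. The symbol $\left(\frac{a}{m}\right)$, for an integer $a$ and a positive integer $m$, is the Kronecker symbol: $\left(\frac{a}{1}\right)=1$; for an odd prime $p$, $\left(\frac{a}{p}\right)$ is the Legendre symbol ($0$ if $p\mid a$, $1$ if $a$ is a nonzero quadratic residue mod $p$, $-1$ otherwise); $\left(\frac{a}{2}\right)=0$ if $a$ is even, $1$ if $a\equiv\pm1\pmod 8$, $-1$ if $a\equiv\pm3\pmod 8$; and $\left(\frac{a}{m}\right)=\prod_{i=1}^{s}\left(\frac{a}{p_i}\right)$ if $m=\prod_{i=1}^{s}p_i$ is the factorization of $m$ into primes (with repetition). *)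

theory Defs
  imports "HOL-Complex_Analysis.Complex_Analysis" "HOL-Number_Theory.Number_Theory"
begin

definition dedekind_eta :: "complex \<Rightarrow> complex" where
  "dedekind_eta \<tau> =
     exp (2 * of_real pi * \<i> * \<tau> / 24) * (\<Prod>n. 1 - exp (2 * of_real pi * \<i> * \<tau>) ^ Suc n)"

definition kronecker_prime :: "int \<Rightarrow> nat \<Rightarrow> int" where
  "kronecker_prime a p =
     (if p = 2 then
        (if even a then 0
         else if [a = 1] (mod 8) \<or> [a = -1] (mod 8) then 1
         else -1)
      else Legendre a (int p))"

text \<open>The bottom argument is meant to be positive; the prime factors are taken with repetition.\<close>

definition kronecker :: "int \<Rightarrow> nat \<Rightarrow> int" where
  "kronecker a m = (\<Prod>p\<in>#prime_factorization m. kronecker_prime a p)"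

end

theory Submission
  imports Defs
begin

text \<open>
  Write \<open>E(x) = \<Prod>(1 - x\<^sup>n)\<close>, so that \<open>\<eta>(k\<tau>)\<close> is a power of \<open>e\<^bsup>2\<pi>i\<tau>/24\<^esup>\<close> times \<open>E(q\<^sup>k)\<close>.
  The finite Jacobi triple product follows from Cauchy's \<open>q\<close>-binomial theorem. Dominated convergence
  turns it into the triple product and hence into Euler's \<open>\<Sum>(-1)\<^sup>k x\<^bsup>k(3k+1)/2\<^esup> = E(x)\<close> and Gauss's
  \<open>\<Sum>(-1)\<^sup>k x\<^bsup>k\<^sup>2\<^esup> = E(x)\<^sup>2/E(x\<^sup>2)\<close>; differentiated at \<open>z = 1\<close> first, it gives Jacobi's formula for \<open>E(x)\<^sup>3\<close>,
  which is (1).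
  Multiplying the two triple products of the quintuple product identity, in differentiated form, gives
  \<open>\<Sum>(6m+1) x\<^bsup>m(3m+1)/2\<^esup> = E(x)\<^sup>5/E(x\<^sup>2)\<^sup>2\<close> (at \<open>z = 1\<close>), which is (5), and
  \<open>\<Sum>(3m+1) y\<^bsup>3m\<^sup>2+2m\<^esup> = E(y)\<^sup>2 E(y\<^sup>4)\<^sup>2/E(y\<^sup>2)\<close> (at \<open>x = y\<^sup>2\<close>, \<open>z = y\<close>), which is (3).
  Finally \<open>E(-x) = E(x\<^sup>2)\<^sup>3/(E(x) E(x\<^sup>4))\<close> transforms (1) into (2) and (5) into (4).
\<close>

section \<open>Values of the Kronecker symbol\<close>

lemma kronecker_of_prime: "prime p \<Longrightarrow> kronecker a p = kronecker_prime a p"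
  by (simp add: kronecker_def prime_factorization_prime)

text \<open>The symbol is a product over prime factors with repetition, so a completely
  multiplicative function that agrees with it at the primes agrees everywhere. This reduces every
  evaluation below to primes.\<close>

lemma kronecker_eqI:
  fixes c :: "nat \<Rightarrow> int"
  assumes "n > 0" and one: "c 1 = 1" and mult: "\<And>k l. c (k * l) = c k * c l"
    and prime: "\<And>p. prime p \<Longrightarrow> kronecker_prime a p = c p"
  shows "kronecker a n = c n"
proof -
  have "c (prod_mset A) = (\<Prod>p\<in>#A. c p)" for A
    by (induction A) (use one in \<open>simp_all add: mult\<close>)
  then have "c n = (\<Prod>p\<in>#prime_factorization n. c p)"
    using prod_mset_prime_factorization_nat[OF assms(1)] by metis
  also have "\<dots> = kronecker a n"
    unfolding kronecker_def using prime
    by (intro arg_cong[of _ _ prod_mset] image_mset_cong) (auto dest: in_prime_factors_imp_prime)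
  finally show ?thesis by simp
qed

text \<open>Turns congruences into equations: Legendre symbols lie in {-1, 0, 1}, so two such values
  differ by at most 2, which is less than an odd prime.\<close>

lemma eq_of_dvd_diff: "p dvd a - b \<Longrightarrow> \<bar>a - b\<bar> < p \<Longrightarrow> a = (b :: int)"
  using dvd_imp_le_int[of "a - b" p] by (cases "a - b = 0") auto

text \<open>By Euler's criterion both sides are congruent to the same power of \<open>a * b\<close>
  modulo p.\<close>

lemma Legendre_mult:
  assumes p: "prime p" "2 < p"
  shows "Legendre (a * b) (int p) = Legendre a (int p) * Legendre b (int p)"
proof -
  have vals: "Legendre c (int p) \<in> {-1, 0, 1}" for c by (auto simp: Legendre_def)
  have "[Legendre (a * b) (int p) = (a * b) ^ ((p - 1) div 2)] (mod int p)"
    by (rule euler_criterion[OF p])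
  moreover have "[Legendre a (int p) * Legendre b (int p) = (a * b) ^ ((p - 1) div 2)] (mod int p)"
    unfolding power_mult_distrib by (intro cong_mult euler_criterion p)
  ultimately have "[Legendre (a * b) (int p) = Legendre a (int p) * Legendre b (int p)] (mod int p)"
    using cong_sym cong_trans by blast
  then have "int p dvd Legendre (a * b) (int p) - Legendre a (int p) * Legendre b (int p)"
    by (simp add: cong_iff_dvd_diff)
  moreover have "\<bar>Legendre (a * b) (int p) - Legendre a (int p) * Legendre b (int p)\<bar> < int p"
    using vals[of a] vals[of b] vals[of "a * b"] p by auto
  ultimately show ?thesis
    by (rule eq_of_dvd_diff)
qed

lemma Legendre_minus_one:
  assumes p: "prime p" "2 < p"
  shows "Legendre (-1) (int p) = (if p mod 4 = 1 then 1 else -1)"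
proof -
  have odd: "odd p" using p prime_odd_nat by blast
  have e: "(-1 :: int) ^ ((p - 1) div 2) = (if p mod 4 = 1 then 1 else -1)"
  proof -
    have "even ((p - 1) div 2) \<longleftrightarrow> p mod 4 = 1" using odd by presburger
    then show ?thesis by (simp add: minus_one_power_iff)
  qed
  have "[Legendre (-1) (int p) = (if p mod 4 = 1 then 1 else -1)] (mod int p)"
    using euler_criterion[OF p, of "-1"] unfolding e .
  then have "int p dvd Legendre (-1) (int p) - (if p mod 4 = 1 then 1 else -1)"
    by (simp add: cong_iff_dvd_diff)
  moreover have "\<bar>Legendre (-1) (int p) - (if p mod 4 = 1 then 1 else -1)\<bar> < int p"
    using p by (auto simp: Legendre_def)
  ultimately show ?thesis
    by (rule eq_of_dvd_diff)
qed

text \<open>Gauss's lemma with multiplier 2: the sign is (-1) to the number of doubled residues that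
  exceed (p - 1)/2.\<close>

lemma Legendre_two:
  assumes p: "prime p" "2 < p"
  shows "Legendre 2 (int p) = (if p mod 8 = 1 \<or> p mod 8 = 7 then 1 else -1)"
proof -
  have odd: "odd p" using p prime_odd_nat by blast
  interpret GAUSS p 2
    using p by unfold_locales (auto simp: cong_0_iff dest: zdvd_imp_le)
  define h where "h = (int p - 1) div 2"
  have h: "int p = 2 * h + 1" using p_eq2 by (simp add: h_def)
  \<comment> \<open>For x up to h, 2x is at most 2h < p, so doubling needs no reduction, and 2x
    exceeds h exactly when x exceeds \<open>h div 2\<close>.\<close>
  have E_eq: "E = (\<lambda>x. 2 * x) ` {h div 2<..h}"
  proof -
    have "x * 2 mod int p = 2 * x" if "0 < x" "x \<le> h" for x
      using that h by simp
    then have "C = (\<lambda>x. 2 * x) ` {0<..h}"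
      unfolding C_def B_def A_def h_def[symmetric] image_image by (intro image_cong) auto
    then show ?thesis
      unfolding E_def h_def[symmetric] by auto
  qed
  have "card E = nat (h - h div 2)"
    unfolding E_eq by (subst card_image) (auto simp: inj_on_def)
  moreover have "even (nat (h - h div 2)) \<longleftrightarrow> p mod 8 = 1 \<or> p mod 8 = 7"
  proof -
    have "h \<ge> 0" using h p by linarith
    then have "even (nat (h - h div 2)) \<longleftrightarrow> even (h - h div 2)" by (simp add: even_nat_iff)
    also have "\<dots> \<longleftrightarrow> int p mod 8 = 1 \<or> int p mod 8 = 7" unfolding h by presburger
    also have "int p mod 8 = int (p mod 8)" by (simp add: zmod_int)
    also have "int (p mod 8) = 1 \<or> int (p mod 8) = 7 \<longleftrightarrow> p mod 8 = 1 \<or> p mod 8 = 7" by linarith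
    finally show ?thesis .
  qed
  ultimately show ?thesis
    using gauss_lemma by (simp add: minus_one_power_iff)
qed

lemma QuadRes_mod: "QuadRes p a \<longleftrightarrow> (\<exists>y. (y mod p)\<^sup>2 mod p = a mod p)"
  by (auto simp: QuadRes_def cong_def power_mod)

lemma Legendre_3: "Legendre a 3 = (if a mod 3 = 0 then 0 else if a mod 3 = 1 then 1 else -1)"
proof -
  have "(y mod 3)\<^sup>2 mod 3 \<noteq> 2" for y :: int
  proof -
    have "y mod 3 = 0 \<or> y mod 3 = 1 \<or> y mod 3 = 2" by presburger
    then show ?thesis by (elim disjE) simp_all
  qed
  moreover have "QuadRes 3 a" if "a mod 3 = 1"
    unfolding QuadRes_mod using that by (intro exI[of _ 1]) simp
  moreover have "a mod 3 = 0 \<or> a mod 3 = 1 \<or> a mod 3 = 2" by presburger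
  ultimately show ?thesis
    unfolding Legendre_def QuadRes_mod by (auto simp: cong_def)
qed

text \<open>Quadratic reciprocity exchanges the symbol for that of p modulo 3 at the cost of a sign
  depending on p modulo 4; the two conditions combine modulo 12.\<close>

lemma Legendre_three:
  assumes p: "prime p" "2 < p"
  shows "Legendre 3 (int p) = (if p mod 12 = 1 \<or> p mod 12 = 11 then 1 else if p mod 3 = 0 then 0 else -1)"
proof (cases "p = 3")
  case True
  then show ?thesis by (simp add: Legendre_3)
next
  case False
  have odd: "odd p" using p prime_odd_nat by blast
  have nd: "p mod 3 \<noteq> 0"
  proof
    assume "p mod 3 = 0"
    then have "3 dvd p" by presburger
    then show False using p(1) False primes_dvd_imp_eq[of 3 p] by simp
  qed
  have qr: "Legendre 3 (int p) * Legendre (int p) 3 = (-1) ^ ((p - 1) div 2)"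
    using Quadratic_Reciprocity[of 3 p] p False by simp
  have s: "(-1 :: int) ^ ((p - 1) div 2) = (if p mod 4 = 1 then 1 else -1)"
  proof -
    have "even ((p - 1) div 2) \<longleftrightarrow> p mod 4 = 1" using odd by presburger
    then show ?thesis by (simp add: minus_one_power_iff)
  qed
  have l: "Legendre (int p) 3 = (if p mod 3 = 1 then 1 else -1)"
  proof -
    have "int p mod 3 = int (p mod 3)" by (simp add: zmod_int)
    then show ?thesis using nd by (simp add: Legendre_3)
  qed
  \<comment> \<open>The symbol is 1 exactly when the two signs agree; this is checked on the twelve
    residues.\<close>
  have "p mod 12 = 1 \<or> p mod 12 = 11 \<longleftrightarrow> (p mod 3 = 1 \<longleftrightarrow> p mod 4 = 1)"
  proof -
    define b where "b = p mod 12"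
    have m: "p mod 3 = b mod 3" "p mod 4 = b mod 4" "p mod 2 = b mod 2"
      unfolding b_def by (simp_all add: mod_mod_cancel)
    have "b \<in> {..<12}" by (simp add: b_def)
    then show ?thesis
      using nd odd unfolding odd_iff_mod_2_eq_one m b_def[symmetric] by (auto simp: lessThan_nat_numeral)
  qed
  then show ?thesis
    using qr nd unfolding s l by (auto split: if_splits)
qed

section \<open>Quadratic characters as functions of residues\<close>

text \<open>\<open>chi_m4\<close>, \<open>chi_m8\<close> and \<open>chi_12\<close> are the quadratic
  characters of conductors 4, 8 and 12 that belong to the fields generated by the square roots of
  -1, -2 and 3. Written by residues, they have multiplicativity as a finite check.\<close>

definition chi_m4 :: "nat \<Rightarrow> int" where
  "chi_m4 n = (if even n then 0 else if n mod 4 = 1 then 1 else -1)"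

definition chi_m8 :: "nat \<Rightarrow> int" where
  "chi_m8 n = (if even n then 0 else if n mod 8 = 1 \<or> n mod 8 = 3 then 1 else -1)"

definition chi_12 :: "nat \<Rightarrow> int" where
  "chi_12 n = (if even n \<or> n mod 3 = 0 then 0 else if n mod 12 = 1 \<or> n mod 12 = 11 then 1 else -1)"

lemma chi_mod: "chi_m4 (n mod 4) = chi_m4 n" "chi_m8 (n mod 8) = chi_m8 n" "chi_12 (n mod 12) = chi_12 n"
proof -
  have *: "even (n mod 4) = even n" "even (n mod 8) = even n" "even (n mod 12) = even n"
    "n mod 12 mod 3 = n mod 3"
    by (simp_all add: dvd_mod_iff mod_mod_cancel)
  show "chi_m4 (n mod 4) = chi_m4 n" "chi_m8 (n mod 8) = chi_m8 n" "chi_12 (n mod 12) = chi_12 n"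
    unfolding chi_m4_def chi_m8_def chi_12_def * by simp_all
qed

lemma multiplicative_by_residues:
  fixes c :: "nat \<Rightarrow> int"
  assumes per: "\<And>n. c (n mod N) = c n" and N: "N > 0"
    and fin: "\<forall>k\<in>{..<N}. \<forall>l\<in>{..<N}. c (k * l mod N) = c k * c l"
  shows "c (k * l) = c k * c l"
proof -
  have "c (k * l) = c ((k mod N) * (l mod N) mod N)" by (simp add: per mod_mult_eq)
  also have "\<dots> = c (k mod N) * c (l mod N)" using fin N by auto
  finally show ?thesis by (simp add: per)
qed

lemma chi_mult:
  "chi_m4 (k * l) = chi_m4 k * chi_m4 l"
  "chi_m8 (k * l) = chi_m8 k * chi_m8 l"
  "chi_12 (k * l) = chi_12 k * chi_12 l"
proof -
  \<comment> \<open>Listing the residues lets \<open>ball_simps\<close> expand the quantifiers into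
    finitely many closed equations; the moduli 8 and 12 are treated alike.\<close>
  have "{..<4::nat} = {0,1,2,3}"
    by (simp add: lessThan_nat_numeral lessThan_Suc, blast)
  then have a: "\<forall>k\<in>{..<4}. \<forall>l\<in>{..<4}. chi_m4 (k * l mod 4) = chi_m4 k * chi_m4 l"
    by (simp only: ball_simps) (simp add: chi_m4_def)
  show "chi_m4 (k * l) = chi_m4 k * chi_m4 l"
    by (rule multiplicative_by_residues[of chi_m4, OF chi_mod(1) _ a]) simp
  have "{..<8::nat} = {0,1,2,3,4,5,6,7}"
    by (simp add: lessThan_nat_numeral lessThan_Suc, blast)
  then have b: "\<forall>k\<in>{..<8}. \<forall>l\<in>{..<8}. chi_m8 (k * l mod 8) = chi_m8 k * chi_m8 l"
    by (simp only: ball_simps) (simp add: chi_m8_def)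
  show "chi_m8 (k * l) = chi_m8 k * chi_m8 l"
    by (rule multiplicative_by_residues[of chi_m8, OF chi_mod(2) _ b]) simp
  have "{..<12::nat} = {0,1,2,3,4,5,6,7,8,9,10,11}"
    by (simp add: lessThan_nat_numeral lessThan_Suc, blast)
  then have c: "\<forall>k\<in>{..<12}. \<forall>l\<in>{..<12}. chi_12 (k * l mod 12) = chi_12 k * chi_12 l"
    by (simp only: ball_simps) (simp add: chi_12_def)
  show "chi_12 (k * l) = chi_12 k * chi_12 l"
    by (rule multiplicative_by_residues[of chi_12, OF chi_mod(3) _ c]) simp
qed

text \<open>At odd primes -4 = (-1) * 2 * 2 and the squared symbol of 2 is 1; at the prime 2 both
  sides vanish.\<close>

lemma kronecker_minus_4:
  assumes "n > 0" shows "kronecker (-4) n = chi_m4 n"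
proof (rule kronecker_eqI[OF assms])
  fix p :: nat assume p: "prime p"
  show "kronecker_prime (-4) p = chi_m4 p"
  proof (cases "p = 2")
    case False
    then have p2: "2 < p" using p prime_gt_1_nat[OF p] by linarith
    have odd: "odd p" using p p2 prime_odd_nat by blast
    have "Legendre (-4) (int p) = Legendre (-1) (int p) * (Legendre 2 (int p) * Legendre 2 (int p))"
      by (simp flip: Legendre_mult[OF p p2])
    also have "\<dots> = chi_m4 p"
      using odd by (simp add: Legendre_minus_one[OF p p2] Legendre_two[OF p p2] chi_m4_def)
    finally show ?thesis using False by (simp add: kronecker_prime_def)
  qed (simp add: kronecker_prime_def chi_m4_def)
qed (simp_all add: chi_mult, simp add: chi_m4_def)

lemma Legendre_minus_2:
  assumes p: "prime p" "2 < p"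
  shows "Legendre (-2) (int p) = chi_m8 p"
proof -
  have odd: "odd p" using p prime_odd_nat by blast
  have "Legendre (-2) (int p) = Legendre (-1) (int p) * Legendre 2 (int p)"
    by (simp flip: Legendre_mult[OF p])
  moreover have "p mod 8 = 1 \<or> p mod 8 = 3 \<longleftrightarrow> (p mod 4 = 1 \<longleftrightarrow> p mod 8 = 1 \<or> p mod 8 = 7)"
  proof -
    define b where "b = p mod 8"
    have m: "p mod 4 = b mod 4" "p mod 2 = b mod 2"
      unfolding b_def by (simp_all add: mod_mod_cancel)
    have "b \<in> {..<8}" by (simp add: b_def)
    then show ?thesis
      using odd unfolding odd_iff_mod_2_eq_one m b_def[symmetric] by (auto simp: lessThan_nat_numeral)
  qed
  ultimately show ?thesis
    using odd by (auto simp add: Legendre_minus_one[OF p] Legendre_two[OF p] chi_m8_def)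
qed

lemma kronecker_minus_2:
  assumes "n > 0" shows "kronecker (-2) n = chi_m8 n"
proof (rule kronecker_eqI[OF assms])
  fix p :: nat assume p: "prime p"
  show "kronecker_prime (-2) p = chi_m8 p"
  proof (cases "p = 2")
    case False
    then have p2: "2 < p" using p prime_gt_1_nat[OF p] by linarith
    then show ?thesis using False by (simp add: kronecker_prime_def Legendre_minus_2[OF p p2])
  qed (simp add: kronecker_prime_def chi_m8_def)
qed (simp_all add: chi_mult, simp add: chi_m8_def)

text \<open>From -6 = (-2) * 3 at odd primes, the symbol of 3 being \<open>chi_12\<close>.\<close>

lemma kronecker_minus_6:
  assumes "n > 0" shows "kronecker (-6) n = chi_m8 n * chi_12 n"
proof (rule kronecker_eqI[OF assms, of "\<lambda>n. chi_m8 n * chi_12 n"])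
  fix p :: nat assume p: "prime p"
  show "kronecker_prime (-6) p = chi_m8 p * chi_12 p"
  proof (cases "p = 2")
    case False
    then have p2: "2 < p" using p prime_gt_1_nat[OF p] by linarith
    have odd: "odd p" using p p2 prime_odd_nat by blast
    have "Legendre (-6) (int p) = Legendre (-2) (int p) * Legendre 3 (int p)"
      by (simp flip: Legendre_mult[OF p p2])
    also have "Legendre 3 (int p) = chi_12 p"
    proof -
      have "p mod 3 = p mod 12 mod 3" by (simp add: mod_mod_cancel)
      then show ?thesis using odd by (auto simp: Legendre_three[OF p p2] chi_12_def)
    qed
    finally show ?thesis using False by (simp add: kronecker_prime_def Legendre_minus_2[OF p p2])
  qed (simp add: kronecker_prime_def chi_m8_def)
qed (simp_all add: chi_mult, simp add: chi_m8_def chi_12_def)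

lemma kronecker_3: "kronecker a 3 = (if a mod 3 = 0 then 0 else if a mod 3 = 1 then 1 else -1)"
  by (simp add: kronecker_of_prime kronecker_prime_def Legendre_3)

text \<open>Here 12 = 2 * 2 * 3 is the bottom argument: the symbol at 2 enters squared and only
  records parity.\<close>

lemma kronecker_12: "kronecker a 12 = (if even a then 0 else kronecker a 3)"
proof -
  have "prime_factorization (2 * 2 * 3 :: nat) = {#2, 2, 3#}"
    by (simp only: prime_factorization_mult) (simp add: prime_factorization_prime)
  then have "kronecker a 12 = kronecker_prime a 2 * kronecker_prime a 2 * kronecker_prime a 3"
    by (simp add: kronecker_def)
  also have "\<dots> = (if even a then 0 else kronecker_prime a 3)"
    by (simp add: kronecker_prime_def)
  finally show ?thesis by (simp add: kronecker_of_prime)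
qed

lemma chi_24: "chi_m8 (24 * a + c) = chi_m8 c" "chi_12 (24 * a + c) = chi_12 c"
proof -
  have "(24 * a + c) mod 8 = c mod 8" "(24 * a + c) mod 12 = c mod 12"
    using mod_mult_self3[of "3 * a" 8 c] mod_mult_self3[of "2 * a" 12 c] by simp_all
  then show "chi_m8 (24 * a + c) = chi_m8 c" "chi_12 (24 * a + c) = chi_12 c"
    using chi_mod(2)[of "24 * a + c"] chi_mod(2)[of c] chi_mod(3)[of "24 * a + c"] chi_mod(3)[of c] by simp_all
qed

section \<open>Sums indexed by the integers\<close>

text \<open>Over the complex numbers unconditional summability is absolute, so the product family is
  absolutely summable and Fubini applies.\<close>

lemma has_sum_Times_mult:
  fixes f :: "'a \<Rightarrow> complex" and g :: "'b \<Rightarrow> complex"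
  assumes f: "(f has_sum a) A" and g: "(g has_sum b) B"
  shows "((\<lambda>(x, y). f x * g y) has_sum a * b) (A \<times> B)"
proof (rule has_sum_SigmaI)
  show "((\<lambda>y. case (x, y) of (x, y) \<Rightarrow> f x * g y) has_sum f x * b) B" for x
    using has_sum_cmult_right[OF g] by simp
  show "((\<lambda>x. f x * b) has_sum a * b) A"
    using has_sum_cmult_left[OF f] by simp
  have "(\<lambda>x. norm (f x)) summable_on A" "(\<lambda>x. norm (g x)) summable_on B"
    using f g summable_on_iff_abs_summable_on_complex has_sum_imp_summable by blast+
  then have "(\<lambda>xy. norm (case xy of (x, y) \<Rightarrow> f x * g y)) summable_on A \<times> B"
    by (subst Infinite_Sum.abs_summable_on_Sigma_iff)
       (auto simp: norm_mult abs_mult infsum_cmult_right' intro!: summable_on_cmult_right summable_on_cmult_left)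
  then show "(\<lambda>(x, y). f x * g y) summable_on A \<times> B"
    by (rule abs_summable_summable)
qed

text \<open>The negative half is indexed by -n - 1 because \<open>tri\<close> takes equal values at
  n and -n - 1.\<close>

lemma has_sum_int_split:
  fixes f :: "int \<Rightarrow> 'a :: {topological_comm_monoid_add}"
  assumes "((\<lambda>n. f (int n)) has_sum a) UNIV" "((\<lambda>n. f (- int n - 1)) has_sum b) UNIV"
  shows "(f has_sum (a + b)) UNIV"
proof -
  have "(f has_sum a) {0..}"
    using assms(1) by (subst has_sum_reindex_bij_witness[of "{0..}" int nat UNIV "\<lambda>n. f (int n)"]) auto
  moreover have "(f has_sum b) {..<0}"
    using assms(2)
    by (subst has_sum_reindex_bij_witness[of "{..<0}" "\<lambda>n. - int n - 1" "\<lambda>k. nat (- k - 1)" UNIV "\<lambda>n. f (- int n - 1)"])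
       auto
  ultimately have "(f has_sum (a + b)) ({0..} \<union> {..<0})"
    by (rule has_sum_Un_disjoint) auto
  also have "{0..} \<union> {..<0} = (UNIV :: int set)" by auto
  finally show ?thesis .
qed

text \<open>Dominated convergence for series over the integers: \<open>int_decode\<close> enumerates
  them, and Tannery's theorem is applied to the enumerated series.\<close>

lemma has_sum_int_dominated:
  fixes f :: "nat \<Rightarrow> int \<Rightarrow> complex"
  assumes lim: "\<And>k. (\<lambda>m. f m k) \<longlonglongrightarrow> g k"
    and bound: "\<And>m k. norm (f m k) \<le> M k" and M: "M summable_on UNIV"
    and sums: "\<And>m. (f m has_sum s m) UNIV" and s: "s \<longlonglongrightarrow> S"
  shows "(g has_sum S) UNIV"
proof -
  note bij = bij_int_decode
  have M': "summable (\<lambda>n. M (int_decode n))"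
    using M summable_on_reindex_bij_betw[OF bij, of M] summable_on_imp_summable by blast
  have g_le: "norm (g k) \<le> M k" for k
    using tendsto_norm[OF lim[of k]] bound by (intro Lim_bounded) auto
  have "g summable_on UNIV"
    by (rule abs_summable_summable, rule Infinite_Sum.abs_summable_on_comparison_test'[OF M g_le])
  then have g: "((\<lambda>n. g (int_decode n)) has_sum infsum g UNIV) UNIV"
    by (subst has_sum_reindex_bij_betw[OF bij]) auto
  have s_eq: "suminf (\<lambda>n. f m (int_decode n)) = s m" for m
    using sums[of m] has_sum_reindex_bij_betw[OF bij, of "f m"] has_sum_imp_sums sums_unique by metis
  have "(\<lambda>m. suminf (\<lambda>n. f m (int_decode n))) \<longlonglongrightarrow> suminf (\<lambda>n. g (int_decode n))"
    using tannerys_theorem[of "\<lambda>n m. f m (int_decode n)" "\<lambda>n. g (int_decode n)" sequentially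
      "\<lambda>n. M (int_decode n)"] lim bound M' by (auto intro: always_eventually)
  then have "suminf (\<lambda>n. g (int_decode n)) = S"
    unfolding s_eq using s LIMSEQ_unique by blast
  moreover have "suminf (\<lambda>n. g (int_decode n)) = infsum g UNIV"
    using has_sum_imp_sums[OF g] sums_unique by metis
  ultimately show ?thesis using \<open>g summable_on UNIV\<close> by auto
qed

section \<open>Jacobi triple product and its derivative\<close>

text \<open>The q-Pochhammer symbol (x; x)_n; \<open>euler_prod\<close> is its limit.\<close>

definition qfac :: "'a::comm_ring_1 \<Rightarrow> nat \<Rightarrow> 'a" where
  "qfac x n = (\<Prod>k<n. 1 - x ^ Suc k)"

definition euler_prod :: "complex \<Rightarrow> complex" where
  "euler_prod x = (\<Prod>n. 1 - x ^ Suc n)"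

text \<open>Triangular numbers indexed by all integers; \<open>3 * tri k - k\<close> = k(3k + 1)/2
  then runs through the generalized pentagonal numbers.\<close>

definition tri :: "int \<Rightarrow> int" where
  "tri k = k * (k + 1) div 2"

lemma two_tri: "2 * tri k = k * (k + 1)"
  by (simp add: tri_def)

lemma tri_of_nat: "tri (int n) = int (n * (n + 1) div 2)"
  by (simp add: tri_def zdiv_int algebra_simps)

lemma tri_minus: "tri (- k - 1) = tri k"
  by (simp add: tri_def algebra_simps)

lemma qfac_Suc: "qfac x (Suc n) = qfac x n * (1 - x ^ Suc n)"
  by (simp add: qfac_def)

lemma one_minus_power_nz: "norm (x::complex) < 1 \<Longrightarrow> 1 - x ^ Suc n \<noteq> 0"
proof
  assume "norm x < 1" "1 - x ^ Suc n = 0"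
  then have "norm x ^ Suc n = 1" by (metis eq_iff_diff_eq_0 norm_one norm_power)
  moreover have "norm x ^ Suc n \<le> norm x ^ 1"
    using \<open>norm x < 1\<close> by (intro power_decreasing) auto
  ultimately show False using \<open>norm x < 1\<close> by simp
qed

lemma qfac_nz: "norm (x::complex) < 1 \<Longrightarrow> qfac x n \<noteq> 0"
  unfolding qfac_def using one_minus_power_nz by (auto simp del: power_Suc)

lemma convergent_prod_one_minus:
  fixes x c :: complex
  assumes "norm x < 1"
  shows "convergent_prod (\<lambda>n. 1 - c * x ^ n)"
proof (rule abs_convergent_prod_imp_convergent_prod, unfold abs_convergent_prod_conv_summable)
  show "summable (\<lambda>n. norm (1 - c * x ^ n - 1))"
    using assms by (simp add: norm_mult norm_power summable_mult)
qed

lemma convergent_prod_lessThan_LIMSEQ: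
  assumes "convergent_prod (f :: nat \<Rightarrow> complex)"
  shows "(\<lambda>n. \<Prod>i<n. f i) \<longlonglongrightarrow> prodinf f"
proof -
  have "(\<lambda>n. \<Prod>i<Suc n. f i) \<longlonglongrightarrow> prodinf f"
    using convergent_prod_LIMSEQ[OF assms] by (simp only: lessThan_Suc_atMost)
  then show ?thesis by (rule LIMSEQ_imp_Suc)
qed

lemma convergent_prod_euler: "norm (x::complex) < 1 \<Longrightarrow> convergent_prod (\<lambda>n. 1 - x ^ Suc n)"
  using convergent_prod_one_minus[of x x] by simp

lemma qfac_LIMSEQ: "norm x < 1 \<Longrightarrow> qfac x \<longlonglongrightarrow> euler_prod x"
  unfolding qfac_def euler_prod_def
  by (rule convergent_prod_lessThan_LIMSEQ[OF convergent_prod_euler])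

lemma euler_prod_nz: "norm x < 1 \<Longrightarrow> euler_prod x \<noteq> 0"
  unfolding euler_prod_def
  by (rule prodinf_nonzero[OF convergent_prod_euler one_minus_power_nz])

section \<open>Gaussian binomials and the finite triple product\<close>

text \<open>The value 0 for j > n makes the last term in the inductive step of
  \<open>cauchy_qbinomial\<close> vanish.\<close>

definition qbinom :: "'a::field \<Rightarrow> nat \<Rightarrow> nat \<Rightarrow> 'a" where
  "qbinom x n j = (if j \<le> n then qfac x n / (qfac x j * qfac x (n - j)) else 0)"

lemma qbinom_0: "norm (x::complex) < 1 \<Longrightarrow> qbinom x n 0 = 1"
  using qfac_nz[of x n] by (simp add: qbinom_def) (simp add: qfac_def)

lemma qbinom_self: "norm (x::complex) < 1 \<Longrightarrow> qbinom x n n = 1"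
  using qfac_nz[of x n] by (simp add: qbinom_def) (simp add: qfac_def)

text \<open>The q-Pascal rule, from 1 - x^(n+1) = (1 - x^(n-j)) + x^(n-j) (1 - x^(j+1)). The case j
  = n is separate since its first summand is the default 0.\<close>

lemma qbinom_Suc_Suc:
  fixes x :: complex
  assumes x: "norm x < 1" and "j \<le> n"
  shows "qbinom x (Suc n) (Suc j) = qbinom x n (Suc j) + x ^ (n - j) * qbinom x n j"
proof (cases "j = n")
  case True
  then show ?thesis by (simp add: qbinom_self[OF x]) (simp add: qbinom_def)
next
  case False
  define d where "d = n - Suc j"
  have n: "n = Suc (j + d)" using False assms by (simp add: d_def)
  have nz: "qfac x j \<noteq> 0" "qfac x d \<noteq> 0" "1 - x * x ^ j \<noteq> 0" "1 - x * x ^ d \<noteq> 0"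
    using qfac_nz[OF x] one_minus_power_nz[OF x, of j] one_minus_power_nz[OF x, of d] by simp_all
  have "1 - x ^ Suc (Suc (j + d)) = (1 - x ^ Suc d) + x ^ Suc d * (1 - x ^ Suc j)"
    by (simp add: power_add algebra_simps)
  then have "qbinom x (Suc n) (Suc j) =
      qfac x n * ((1 - x ^ Suc d) + x ^ Suc d * (1 - x ^ Suc j)) / (qfac x (Suc j) * qfac x (Suc d))"
    by (simp add: qbinom_def n qfac_Suc[of x "Suc (j + d)"])
  also have "\<dots> = qfac x n / (qfac x (Suc j) * qfac x d) + x ^ Suc d * (qfac x n / (qfac x j * qfac x (Suc d)))"
    using nz by (simp add: qfac_Suc divide_simps) (simp add: algebra_simps)
  finally show ?thesis
    by (simp add: qbinom_def n Suc_diff_le)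
qed

lemma cauchy_qbinomial:
  fixes x t :: complex
  assumes x: "norm x < 1"
  shows "(\<Prod>k<n. 1 + t * x ^ k) = (\<Sum>j\<le>n. x ^ (j choose 2) * qbinom x n j * t ^ j)"
proof (induction n)
  case 0
  then show ?case using qbinom_0[OF x] by (simp add: binomial_eq_0)
next
  case (Suc n)
  let ?f = "\<lambda>n j. x ^ (j choose 2) * qbinom x n j * t ^ j"
  have [simp]: "0 choose 2 = (0::nat)" by (simp add: binomial_eq_0)
  have step: "?f (Suc n) (Suc j) = ?f n (Suc j) + t * x ^ n * ?f n j" if "j \<le> n" for j
  proof -
    \<comment> \<open>The extra x^j joins the x^(n-j) of the q-Pascal rule to give x^n, the power in
      the new factor of the product.\<close>
    have c: "Suc j choose 2 = (j choose 2) + j"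
      by (simp add: numeral_2_eq_2)
    have "x ^ n = x ^ (n - j) * x ^ j" using that by (simp flip: power_add)
    then show ?thesis
      by (simp add: qbinom_Suc_Suc[OF x that] c power_add algebra_simps)
  qed
  have "(\<Sum>j\<le>Suc n. ?f (Suc n) j) = 1 + (\<Sum>j\<le>n. ?f (Suc n) (Suc j))"
    by (subst sum.atMost_Suc_shift) (simp add: qbinom_0[OF x])
  also have "\<dots> = (1 + (\<Sum>j\<le>n. ?f n (Suc j))) + t * x ^ n * (\<Sum>j\<le>n. ?f n j)"
    using step by (simp add: sum.distrib sum_distrib_left)
  also have "1 + (\<Sum>j\<le>n. ?f n (Suc j)) = (\<Sum>j\<le>Suc n. ?f n j)"
    using sum.atMost_Suc_shift[of "?f n" n] by (simp add: qbinom_0[OF x])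
  also have "\<dots> = (\<Sum>j\<le>n. ?f n j)" by (simp add: qbinom_def)
  finally show ?case using Suc.IH by (simp add: algebra_simps)
qed

text \<open>Cauchy's theorem with 2m factors, recentred: its first m factors become the product in
  1/z, its last m factors the product in z.\<close>

lemma finite_jacobi_triple:
  fixes x z :: complex
  assumes x: "norm x < 1" "x \<noteq> 0" and z: "z \<noteq> 0"
  shows "(\<Prod>k<m. 1 - z * x ^ Suc k) * (\<Prod>k<m. 1 - inverse z * x ^ k) =
    (\<Sum>k=- int m..int m. (-1) powi k * x powi tri k * z powi k * qbinom x (2 * m) (nat (k + int m)))"
proof -
  \<comment> \<open>This t makes the factors run from 1 - z x^(1-m) to 1 - z x^m. \<open>C\<close>
    collects the monomials -z x^(-k) pulled out of the first m of them.\<close>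
  define t where "t = - z * x powi (1 - int m)"
  define C where "C = (- z) ^ m * x powi - tri (int m - 1)"
  have nz: "t \<noteq> 0" "C \<noteq> 0" using x z by (auto simp: t_def C_def)
  have low: "1 + t * x ^ k = - z * x powi - int (m - 1 - k) * (1 - inverse z * x ^ (m - 1 - k))"
    if "k < m" for k
  proof -
    have "x powi (1 - int m) * x ^ k = x powi - int (m - 1 - k)"
      using x that by (simp add: power_int_add[symmetric] of_nat_diff algebra_simps flip: power_int_of_nat)
    then have "1 + t * x ^ k = 1 - z * x powi - int (m - 1 - k)"
      by (simp add: t_def mult.assoc)
    also have "\<dots> = - z * x powi - int (m - 1 - k) * (1 - inverse z * x ^ (m - 1 - k))"
      using x z by (simp add: power_int_minus field_simps)
    finally show ?thesis .
  qed
  have high: "1 + t * x ^ (m + k) = 1 - z * x ^ Suc k" for k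
  proof -
    have "x powi (1 - int m) * x ^ (m + k) = x ^ Suc k"
      using x by (simp add: power_int_add[symmetric] flip: power_int_of_nat)
    then show ?thesis by (simp add: t_def mult.assoc)
  qed
  have C: "(\<Prod>k<m. - z * x powi - int k) = C"
    unfolding C_def
  proof (induction m)
    case 0
    then show ?case by (simp add: tri_def)
  next
    case (Suc m)
    have "- tri (int (Suc m) - 1) = - tri (int m - 1) - int m"
      using two_tri[of "int m"] two_tri[of "int m - 1"] by (simp add: algebra_simps)
    then have "x powi - tri (int (Suc m) - 1) = x powi - tri (int m - 1) * x powi - int m"
      using x by (simp add: power_int_add[symmetric])
    then show ?case using Suc.IH by simp
  qed
  have "(\<Prod>k<2*m. 1 + t * x ^ k) = (\<Prod>k<m. 1 + t * x ^ k) * (\<Prod>k<m. 1 + t * x ^ (m + k))"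
    by (simp add: mult_2 prod.atLeastLessThan_concat[of 0 m "m + m", symmetric] lessThan_atLeast0
        prod.shift_bounds_nat_ivl[of _ 0 m m, simplified] add.commute)
  \<comment> \<open>Reversal k -> m - 1 - k puts the first half into increasing powers of x.\<close>
  also have "(\<Prod>k<m. 1 + t * x ^ k) = (\<Prod>k<m. - z * x powi - int k * (1 - inverse z * x ^ k))"
    using low by (subst (2) prod.nat_diff_reindex[symmetric]) (intro prod.cong refl, simp)
  also have "\<dots> = C * (\<Prod>k<m. 1 - inverse z * x ^ k)"
    by (simp only: C[symmetric] prod.distrib)
  also have "(\<Prod>k<m. 1 + t * x ^ (m + k)) = (\<Prod>k<m. 1 - z * x ^ Suc k)"
    using high by simp
  finally have "C * ((\<Prod>k<m. 1 - z * x ^ Suc k) * (\<Prod>k<m. 1 - inverse z * x ^ k)) =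
      (\<Sum>j\<le>2*m. x ^ (j choose 2) * qbinom x (2 * m) j * t ^ j)"
    by (simp add: cauchy_qbinomial[OF x(1)] mult_ac)
  also have "\<dots> = (\<Sum>k=- int m..int m. x ^ (nat (k + int m) choose 2) * qbinom x (2 * m) (nat (k + int m)) * t ^ nat (k + int m))"
    by (rule sum.reindex_bij_witness[of _ "\<lambda>k. nat (k + int m)" "\<lambda>j. int j - int m"]) auto
  also have "\<dots> = (\<Sum>k=- int m..int m. C * ((-1) powi k * x powi tri k * z powi k * qbinom x (2 * m) (nat (k + int m))))"
  proof (intro sum.cong refl)
    fix k assume k: "k \<in> {- int m..int m}"
    define j where "j = nat (k + int m)"
    have k_eq: "k = int j - int m" using k by (simp add: j_def)
    have c: "int (j choose 2) = tri (int j - 1)"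
      by (simp add: choose_two tri_def zdiv_int) (cases j; simp add: algebra_simps)
    \<comment> \<open>With j = k + m the exponent separates into the part belonging to
      \<open>C\<close> and the triangular number of k.\<close>
    have e: "tri (int j - 1) + (1 - int m) * int j = - tri (int m - 1) + tri k"
      using two_tri[of "int j - 1"] two_tri[of "int m - 1"] two_tri[of k]
      unfolding k_eq by (simp add: algebra_simps)
    have "x ^ (j choose 2) * t ^ j = (- z) ^ j * (x powi tri (int j - 1) * x powi ((1 - int m) * int j))"
      unfolding t_def power_mult_distrib by (simp add: c[symmetric] power_int_mult)
    also have "\<dots> = (- z) ^ j * (x powi - tri (int m - 1) * x powi tri k)"
      using x by (simp add: power_int_add[symmetric] e)
    also have "(- z) ^ j = (- z) ^ m * ((- z) powi k)"
      using z by (simp add: k_eq power_int_diff)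
    also have "(- z) powi k = (-1) powi k * z powi k"
      by (simp flip: power_int_mult_distrib)
    finally show "x ^ (nat (k + int m) choose 2) * qbinom x (2 * m) (nat (k + int m)) * t ^ nat (k + int m) =
        C * ((-1) powi k * x powi tri k * z powi k * qbinom x (2 * m) (nat (k + int m)))"
      unfolding j_def[symmetric] C_def by (simp add: mult_ac)
  qed
  finally show ?thesis
    using nz by (simp flip: sum_distrib_left)
qed

section \<open>Majorants and passage to the limit\<close>

text \<open>Ratio test: consecutive terms have quotient at most 2 c r^(n+1), which tends to 0. The
  factor n + 1 covers differentiated series as well.\<close>

lemma summable_theta_nat:
  fixes r c :: real
  assumes r: "0 \<le> r" "r < 1" and c: "c \<ge> 0"
  shows "summable (\<lambda>n. real (n + 1) * (r ^ (n * (n + 1) div 2) * c ^ n))"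
proof -
  have "(\<lambda>n. 2 * c * (r * r ^ n)) \<longlonglongrightarrow> 2 * c * (r * 0)"
    using r by (intro tendsto_intros LIMSEQ_realpow_zero) auto
  then have "eventually (\<lambda>n. 2 * c * (r * r ^ n) < 1/2) sequentially"
    by (rule order_tendstoD) simp
  then obtain N where N: "\<And>n. n \<ge> N \<Longrightarrow> 2 * c * (r * r ^ n) < 1/2"
    by (auto simp: eventually_sequentially)
  show ?thesis
  proof (rule summable_ratio_test[of "1/2" N])
    fix n assume "n \<ge> N"
    define T where "T = real (n + 1) * (r ^ (n * (n + 1) div 2) * c ^ n)"
    have T: "T \<ge> 0" using r c by (simp add: T_def)
    have half: "a div 2 = b div 2 + l" if "a = b + 2 * l" for a b l :: nat
      using that by simp
    have "Suc n * (Suc n + 1) div 2 = n * (n + 1) div 2 + Suc n"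
      by (rule half) simp
    then have "r ^ (Suc n * (Suc n + 1) div 2) = r ^ (n * (n + 1) div 2) * (r * r ^ n)"
      by (simp only: power_add power_Suc)
    then have "real (Suc n + 1) * (r ^ (Suc n * (Suc n + 1) div 2) * c ^ Suc n)
        = real (n + 2) * (r ^ (n * (n + 1) div 2) * c ^ n * (c * (r * r ^ n)))"
      by (simp only: power_Suc mult_ac) (simp only: add_Suc add_Suc_right numeral_2_eq_2 One_nat_def)
    also have "\<dots> \<le> (2 * real (n + 1)) * (r ^ (n * (n + 1) div 2) * c ^ n * (c * (r * r ^ n)))"
      using r c by (intro mult_right_mono) auto
    also have "\<dots> = T * (2 * c * (r * r ^ n))" by (simp add: T_def mult_ac)
    also have "\<dots> \<le> T * (1/2)" using T N[OF \<open>n \<ge> N\<close>] by (intro mult_left_mono) auto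
    finally show "norm (real (Suc n + 1) * (r ^ (Suc n * (Suc n + 1) div 2) * c ^ Suc n))
        \<le> 1/2 * norm (real (n + 1) * (r ^ (n * (n + 1) div 2) * c ^ n))"
      using r c by (simp add: T_def abs_mult)
  qed simp
qed

lemma powi_tri_of_nat:
  "(x :: 'a :: division_ring) powi tri (int n) = x ^ (n * (n + 1) div 2)"
  by (simp only: tri_of_nat power_int_of_nat)

text \<open>On the negative half, k = -n - 1 keeps \<open>tri\<close> and replaces z by 1/z. The
  weight |k| + 1 dominates both 1 and |k|, so one majorant serves the theta series and its
  derivative.\<close>

lemma summable_theta_norm:
  fixes x z :: complex
  assumes x: "norm x < 1"  and z: "z \<noteq> 0"
  shows "(\<lambda>k::int. (\<bar>real_of_int k\<bar> + 1) * (norm x powi tri k * norm z powi k)) summable_on UNIV"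
proof -
  let ?f = "\<lambda>k::int. (\<bar>real_of_int k\<bar> + 1) * (norm x powi tri k * norm z powi k)"
  have 1: "(\<lambda>n. ?f (int n)) summable_on UNIV"
  proof -
    have eq: "(\<lambda>n. ?f (int n)) = (\<lambda>n. real (n + 1) * (norm x ^ (n * (n + 1) div 2) * norm z ^ n))"
      by (simp only: powi_tri_of_nat power_int_of_nat) (simp add: add_ac)
    show ?thesis
      unfolding eq using summable_theta_nat[of "norm x" "norm z"] x
      by (subst summable_on_UNIV_nonneg_real_iff) auto
  qed
  have 2: "(\<lambda>n. ?f (- int n - 1)) summable_on UNIV"
  proof (rule summable_on_comparison_test)
    let ?w = "inverse (norm z)"
    show "(\<lambda>n. 2 * ?w * (real (n + 1) * (norm x ^ (n * (n + 1) div 2) * ?w ^ n))) summable_on UNIV"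
      using summable_theta_nat[of "norm x" ?w] x
      by (intro summable_on_cmult_right, subst summable_on_UNIV_nonneg_real_iff) auto
    fix n
    have "norm z powi (- int n - 1) = ?w * ?w ^ n"
      using z by (simp add: power_int_diff power_int_minus field_simps)
    then have "?f (- int n - 1) = (real n + 2) * (norm x ^ (n * (n + 1) div 2) * (?w * ?w ^ n))"
      by (simp only: tri_minus powi_tri_of_nat) simp
    also have "\<dots> \<le> (2 * real (n + 1)) * (norm x ^ (n * (n + 1) div 2) * (?w * ?w ^ n))"
      by (intro mult_right_mono) auto
    finally show "?f (- int n - 1) \<le> 2 * ?w * (real (n + 1) * (norm x ^ (n * (n + 1) div 2) * ?w ^ n))"
      by (simp only: mult_ac)
    show "0 \<le> ?f (- int n - 1)" by simp
  qed
  obtain a b where "((\<lambda>n. ?f (int n)) has_sum a) UNIV" "((\<lambda>n. ?f (- int n - 1)) has_sum b) UNIV"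
    using 1 2 unfolding summable_on_def by blast
  then show ?thesis
    using has_sum_int_split[of ?f a b] has_sum_imp_summable by blast
qed

text \<open>For large m the three q-factorials have indices 2m, m + k and m - k, all tending to
  infinity, so the quotient tends to E/(E * E).\<close>

lemma qbinom_central_LIMSEQ:
  assumes x: "norm (x :: complex) < 1"
  shows "(\<lambda>m. qbinom x (2 * m) (nat (k + int m))) \<longlonglongrightarrow> inverse (euler_prod x)"
proof -
  have l1: "filterlim (\<lambda>m. nat (k + int m)) sequentially sequentially"
    by (rule filterlim_at_top_mono[OF filterlim_minus_const_nat_at_top[of "nat \<bar>k\<bar>"]])
       (auto intro!: always_eventually)
  have l2: "filterlim (\<lambda>m. 2 * m - nat (k + int m)) sequentially sequentially"
    by (rule filterlim_at_top_mono[OF filterlim_minus_const_nat_at_top[of "nat \<bar>k\<bar>"]])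
       (auto intro!: always_eventually)
  have l3: "filterlim (\<lambda>m::nat. 2 * m) sequentially sequentially"
    by (rule filterlim_at_top_mono[OF filterlim_ident]) (auto intro!: always_eventually)
  note q = qfac_LIMSEQ[OF x] and nz = euler_prod_nz[OF x]
  have "(\<lambda>m. qfac x (2 * m) / (qfac x (nat (k + int m)) * qfac x (2 * m - nat (k + int m))))
      \<longlonglongrightarrow> euler_prod x / (euler_prod x * euler_prod x)"
    using nz by (intro tendsto_intros filterlim_compose[OF q l1] filterlim_compose[OF q l2]
      filterlim_compose[OF q l3]) auto
  moreover have "eventually (\<lambda>m. qfac x (2 * m) / (qfac x (nat (k + int m)) * qfac x (2 * m - nat (k + int m)))
      = qbinom x (2 * m) (nat (k + int m))) sequentially"
    using eventually_ge_at_top[of "nat \<bar>k\<bar>"] by eventually_elim (auto simp: qbinom_def)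
  ultimately have "(\<lambda>m. qbinom x (2 * m) (nat (k + int m))) \<longlonglongrightarrow> euler_prod x / (euler_prod x * euler_prod x)"
    using tendsto_cong by fast
  then show ?thesis using nz by (simp add: field_simps)
qed

text \<open>\<open>qfac x\<close> has a nonzero limit, so it and its reciprocal are bounded; the
  bound is uniform in both indices, as domination requires.\<close>

lemma qbinom_bounded:
  assumes x: "norm (x :: complex) < 1"
  obtains B where "\<And>n j. norm (qbinom x n j) \<le> B"
proof -
  have q: "qfac x \<longlonglongrightarrow> euler_prod x" by (rule qfac_LIMSEQ[OF x])
  then have "Bseq (qfac x)" using convergentI convergent_imp_Bseq by blast
  then obtain K where K: "\<And>n. norm (qfac x n) \<le> K" by (auto simp: Bseq_def)
  have "Bseq (\<lambda>n. inverse (qfac x n))"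
    using tendsto_inverse[OF q euler_prod_nz[OF x]] convergentI convergent_imp_Bseq by blast
  then obtain L where L: "\<And>n. norm (inverse (qfac x n)) \<le> L" by (auto simp: Bseq_def)
  have nn: "K \<ge> 0" "L \<ge> 0" using K[of 0] L[of 0] norm_ge_zero order_trans by blast+
  have "norm (qbinom x n j) \<le> K * (L * L)" for n j
  proof (cases "j \<le> n")
    case True
    then have "norm (qbinom x n j) = norm (qfac x n) * (norm (inverse (qfac x j)) * norm (inverse (qfac x (n - j))))"
      by (simp add: qbinom_def norm_divide norm_mult norm_inverse divide_inverse)
    also have "\<dots> \<le> K * (L * L)"
      using K L nn by (intro mult_mono) auto
    finally show ?thesis .
  qed (use nn in \<open>simp add: qbinom_def\<close>)
  then show ?thesis by (rule that)
qed

text \<open>The finite sums, extended by zero, converge termwise to h k / E(x) under a constant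
  multiple of |h|; multiplying by E(x) clears the denominator.\<close>

lemma has_sum_qbinom_limit:
  fixes x :: complex
  assumes x: "norm x < 1" and h: "h summable_on UNIV"
    and L: "(\<lambda>m. \<Sum>k=- int m..int m. h k * qbinom x (2 * m) (nat (k + int m))) \<longlonglongrightarrow> L"
  shows "(h has_sum (euler_prod x * L)) UNIV"
proof -
  obtain B where B: "\<And>n j. norm (qbinom x n j) \<le> B" using qbinom_bounded[OF x] by blast
  have B0: "B \<ge> 0" using B[of 0 0] norm_ge_zero order_trans by blast
  define f where "f m k = (if k \<in> {- int m..int m} then h k * qbinom x (2 * m) (nat (k + int m)) else 0)" for m k
  have "((\<lambda>k. h k * inverse (euler_prod x)) has_sum L) UNIV"
  proof (rule has_sum_int_dominated)
    fix k
    have "eventually (\<lambda>m. h k * qbinom x (2 * m) (nat (k + int m)) = f m k) sequentially"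
      using eventually_ge_at_top[of "nat \<bar>k\<bar>"] by eventually_elim (auto simp: f_def)
    then show "(\<lambda>m. f m k) \<longlonglongrightarrow> h k * inverse (euler_prod x)"
      using tendsto_mult_left[OF qbinom_central_LIMSEQ[OF x, of k], of "h k"] tendsto_cong by fast
    show "norm (f m k) \<le> norm (h k) * B" for m
      using B B0 by (auto simp: f_def norm_mult intro!: mult_left_mono)
  next
    show "(\<lambda>k. norm (h k) * B) summable_on UNIV"
      using h by (intro summable_on_cmult_left) (simp add: summable_on_iff_abs_summable_on_complex)
    show "(f m has_sum (\<Sum>k=- int m..int m. h k * qbinom x (2 * m) (nat (k + int m)))) UNIV" for m
      by (rule has_sum_finite_neutralI[of "{- int m..int m}"]) (auto simp: f_def)
  qed (rule L)
  from has_sum_cmult_right[OF this, of "euler_prod x"] show ?thesis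
    using euler_prod_nz[OF x] by (simp add: field_simps)
qed

lemma summable_theta:
  fixes x z :: complex
  assumes x: "norm x < 1" and z: "z \<noteq> 0"
  shows "(\<lambda>k::int. of_int k * ((-1) powi k * x powi tri k * z powi k)) summable_on UNIV"
    and "(\<lambda>k::int. (-1) powi k * x powi tri k * z powi k) summable_on UNIV"
  by (rule abs_summable_summable, rule Infinite_Sum.abs_summable_on_comparison_test'[OF summable_theta_norm[OF x z]],
      auto simp: norm_mult norm_power_int abs_mult distrib_right intro!: mult_right_mono mult_nonneg_nonneg)+

text \<open>The limit of the products enters as a parameter, so that each specialization of z can
  identify it by regrouping finite products.\<close>

theorem jacobi_triple:
  fixes x z :: complex
  assumes x: "norm x < 1" "x \<noteq> 0" and z: "z \<noteq> 0"
    and L: "(\<lambda>m. (\<Prod>k<m. 1 - z * x ^ Suc k) * (\<Prod>k<m. 1 - inverse z * x ^ k)) \<longlonglongrightarrow> L"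
  shows "((\<lambda>k::int. (-1) powi k * x powi tri k * z powi k) has_sum (euler_prod x * L)) UNIV"
  using has_sum_qbinom_limit[OF x(1) summable_theta(2)[OF x(1) z]] L
  unfolding finite_jacobi_triple[OF x z] .

text \<open>Differentiating the finite triple product at \<open>z = 1\<close>, where the factor \<open>1 - 1/z\<close> vanishes.\<close>

lemma finite_jacobi_cube:
  fixes x :: complex
  assumes x: "norm x < 1" "x \<noteq> 0"
  shows "qfac x (Suc m) * qfac x m = (\<Sum>k=- int (Suc m)..int (Suc m).
    of_int k * ((-1) powi k * x powi tri k * 1 powi k) * qbinom x (2 * Suc m) (nat (k + int (Suc m))))"
proof -
  \<comment> \<open>\<open>H\<close> is the triple product without its factor 1 - 1/z, hence one
    factor fewer in the second product.\<close>
  define H where "H z = (\<Prod>k<Suc m. 1 - z * x ^ Suc k) * (\<Prod>k<m. 1 - inverse z * x ^ Suc k)" for z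
  define c where "c k = (-1) powi k * x powi tri k * qbinom x (2 * Suc m) (nat (k + int (Suc m)))" for k
  define S where "S z = (\<Sum>k=- int (Suc m)..int (Suc m). c k * z powi k)" for z
  have eq: "S z = (z - 1) * (H z / z)" if "z \<noteq> 0" for z
  proof -
    have "S z = (\<Prod>k<Suc m. 1 - z * x ^ Suc k) * (\<Prod>k<Suc m. 1 - inverse z * x ^ k)"
      unfolding finite_jacobi_triple[OF x that] by (simp only: S_def c_def mult_ac)
    also have "\<dots> = (1 - inverse z) * H z"
      unfolding H_def prod.lessThan_Suc_shift[of _ m] by (simp add: mult_ac)
    also have "\<dots> = (z - 1) * (H z / z)" using that by (simp add: field_simps)
    finally show ?thesis .
  qed
  \<comment> \<open>Caratheodory's form of the derivative: (z - 1) g(z) with g continuous at 1 has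
    derivative g(1). The value \<open>H 1\<close> is the product of two q-factorials.\<close>
  have "isCont (\<lambda>z. H z / z) 1" unfolding H_def by (intro continuous_intros) auto
  then have "((\<lambda>z. (z - 1) * (H z / z)) has_field_derivative H 1 / 1) (at 1)"
    unfolding CARAT_DERIV by (intro exI[of _ "\<lambda>z. H z / z"]) simp
  moreover have "eventually (\<lambda>z. (z - 1) * (H z / z) = S z) (nhds 1)"
    using t1_space_nhds[of 1 "0::complex"] by (rule eventually_mono) (simp_all add: eq)
  ultimately have "(S has_field_derivative H 1) (at 1)"
    by (subst DERIV_cong_ev[OF refl _ refl, symmetric]) auto
  moreover have "(S has_field_derivative (\<Sum>k=- int (Suc m)..int (Suc m). c k * of_int k)) (at 1)"
    unfolding S_def by (auto intro!: derivative_eq_intros sum.cong)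
  ultimately have "H 1 = (\<Sum>k=- int (Suc m)..int (Suc m). c k * of_int k)"
    by (rule DERIV_unique)
  then show ?thesis by (simp add: H_def c_def qfac_def mult_ac)
qed

theorem jacobi_cube:
  fixes x :: complex
  assumes x: "norm x < 1" "x \<noteq> 0"
  shows "((\<lambda>k::int. of_int k * ((-1) powi k * x powi tri k)) has_sum euler_prod x ^ 3) UNIV"
proof -
  let ?h = "\<lambda>k::int. of_int k * ((-1) powi k * x powi tri k * 1 powi k)"
  \<comment> \<open>The index is shifted because a factor can be removed only from a nonempty
    product; the shift is undone in the limit.\<close>
  have "(\<lambda>m. \<Sum>k=- int (Suc m)..int (Suc m). ?h k * qbinom x (2 * Suc m) (nat (k + int (Suc m))))
      \<longlonglongrightarrow> euler_prod x * euler_prod x"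
    unfolding finite_jacobi_cube[OF x, symmetric]
    by (intro tendsto_mult qfac_LIMSEQ LIMSEQ_Suc x)
  then have "(\<lambda>m. \<Sum>k=- int m..int m. ?h k * qbinom x (2 * m) (nat (k + int m)))
      \<longlonglongrightarrow> euler_prod x * euler_prod x"
    by (rule LIMSEQ_imp_Suc)
  from has_sum_qbinom_limit[OF x(1) summable_theta(1)[OF x(1), of 1] this] show ?thesis
    by (simp add: power3_eq_cube mult_ac)
qed

section \<open>Theta series as products\<close>

lemma neg_one_powi: "(-1 :: complex) powi n = (if even n then 1 else -1)"
  by (auto simp: power_int_def minus_one_power_iff even_nat_iff)

lemma neg_one_powi_eqI: "even (a - b) \<Longrightarrow> (-1 :: complex) powi a = (-1) powi b"
  by (auto simp: neg_one_powi)

lemma power_powi: "(x ^ n) powi k = (x :: complex) powi (int n * k)"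
  by (simp add: power_int_mult)

lemma inverse_powi: "inverse x powi k = (x :: complex) powi (- k)"
  by (simp add: power_int_minus power_int_inverse)

text \<open>The product of 1 - x^(2n+1), that is (x; x^2)_infinity.\<close>

definition odd_euler_prod :: "complex \<Rightarrow> complex" where
  "odd_euler_prod x = (\<Prod>n. 1 - x * (x\<^sup>2) ^ n)"

lemma norm_power_less_one: "norm (x :: complex) < 1 \<Longrightarrow> n > 0 \<Longrightarrow> norm (x ^ n) < 1"
  by (simp add: norm_power power_less_one_iff)

lemma odd_euler_prod_LIMSEQ:
  "norm x < 1 \<Longrightarrow> (\<lambda>n. \<Prod>k<n. 1 - x * (x\<^sup>2) ^ k) \<longlonglongrightarrow> odd_euler_prod x"
  unfolding odd_euler_prod_def
  by (intro convergent_prod_lessThan_LIMSEQ convergent_prod_one_minus norm_power_less_one) auto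

text \<open>Splits the factors 1 - x^j by the parity of j, first in the finite products.\<close>

lemma odd_even_euler_prod:
  assumes x: "norm x < 1"
  shows "odd_euler_prod x * euler_prod (x\<^sup>2) = euler_prod x"
proof -
  have "qfac x (2 * n) = (\<Prod>k<n. 1 - x * (x\<^sup>2) ^ k) * qfac (x\<^sup>2) n" for n
  proof (induction n)
    case (Suc n)
    have "2 * Suc n = Suc (Suc (2 * n))" "x * (x\<^sup>2) ^ n = x ^ Suc (2 * n)"
        "(x\<^sup>2) ^ Suc n = x ^ Suc (Suc (2 * n))"
      by (simp_all add: power_mult power2_eq_square)
    then show ?case
      using Suc.IH by (simp only: prod.lessThan_Suc qfac_Suc mult_ac)
  qed (simp add: qfac_def)
  moreover have "(\<lambda>n. qfac x (2 * n)) \<longlonglongrightarrow> euler_prod x"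
    by (rule filterlim_compose[OF qfac_LIMSEQ[OF x]])
       (auto intro!: filterlim_subseq simp: strict_mono_def)
  moreover have "(\<lambda>n. (\<Prod>k<n. 1 - x * (x\<^sup>2) ^ k) * qfac (x\<^sup>2) n)
      \<longlonglongrightarrow> odd_euler_prod x * euler_prod (x\<^sup>2)"
    using x by (intro tendsto_mult odd_euler_prod_LIMSEQ qfac_LIMSEQ norm_power_less_one) auto
  ultimately show ?thesis
    using LIMSEQ_unique by auto
qed

text \<open>The sign change affects only odd exponents, and there (1 - x^j)(1 + x^j) = 1 - x^(2j)
  relates the odd products of x, -x and x^2.\<close>

lemma euler_prod_minus:
  assumes x: "norm x < 1"
  shows "euler_prod (- x) = euler_prod (x\<^sup>2) ^ 3 / (euler_prod x * euler_prod (x ^ 4))"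
proof -
  have "odd_euler_prod x * odd_euler_prod (- x) = odd_euler_prod (x\<^sup>2)"
  proof -
    have "(\<Prod>k<n. 1 - x * (x\<^sup>2) ^ k) * (\<Prod>k<n. 1 - (- x) * ((- x)\<^sup>2) ^ k)
        = (\<Prod>k<n. 1 - x\<^sup>2 * ((x\<^sup>2)\<^sup>2) ^ k)" for n
      unfolding prod.distrib[symmetric]
      by (intro prod.cong refl) (simp add: algebra_simps power2_eq_square power_mult_distrib)
    moreover have "(\<lambda>n. (\<Prod>k<n. 1 - x * (x\<^sup>2) ^ k) * (\<Prod>k<n. 1 - (- x) * ((- x)\<^sup>2) ^ k))
        \<longlonglongrightarrow> odd_euler_prod x * odd_euler_prod (- x)"
      using x by (intro tendsto_mult odd_euler_prod_LIMSEQ) auto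
    moreover have "(\<lambda>n. \<Prod>k<n. 1 - x\<^sup>2 * ((x\<^sup>2)\<^sup>2) ^ k) \<longlonglongrightarrow> odd_euler_prod (x\<^sup>2)"
      using x by (intro odd_euler_prod_LIMSEQ norm_power_less_one) auto
    ultimately show ?thesis using LIMSEQ_unique by auto
  qed
  note c = this
  have e2: "odd_euler_prod (x\<^sup>2) * euler_prod (x ^ 4) = euler_prod (x\<^sup>2)"
    using odd_even_euler_prod[of "x\<^sup>2"] norm_power_less_one[OF x, of 2] by simp
  have "euler_prod (- x) * (euler_prod x * euler_prod (x ^ 4))
      = (odd_euler_prod (- x) * euler_prod (x\<^sup>2)) * ((odd_euler_prod x * euler_prod (x\<^sup>2)) * euler_prod (x ^ 4))"
    using odd_even_euler_prod[of "- x"] odd_even_euler_prod[OF x] x by simp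
  also have "\<dots> = (odd_euler_prod x * odd_euler_prod (- x) * euler_prod (x ^ 4)) * euler_prod (x\<^sup>2) ^ 2"
    by (simp add: power2_eq_square mult_ac)
  also have "\<dots> = euler_prod (x\<^sup>2) ^ 3"
    unfolding c e2 by (simp add: power2_eq_square power3_eq_cube)
  finally show ?thesis
    using euler_prod_nz[OF x] euler_prod_nz[OF norm_power_less_one[OF x, of 4]]
    by (simp add: field_simps)
qed

text \<open>The triple product in base x^2 at z = 1/x: both products become
  \<open>odd_euler_prod x\<close>, and 2 tri k - k = k^2.\<close>

theorem gauss_square_theta:
  fixes x :: complex
  assumes x: "norm x < 1" "x \<noteq> 0"
  shows "((\<lambda>k::int. (-1) powi k * x powi k\<^sup>2) has_sum euler_prod x ^ 2 / euler_prod (x\<^sup>2)) UNIV"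
proof -
  have x2: "norm (x\<^sup>2) < 1" "x\<^sup>2 \<noteq> 0" using x norm_power_less_one[of x 2] by auto
  have "((\<lambda>k::int. (-1) powi k * (x\<^sup>2) powi tri k * inverse x powi k) has_sum
      (euler_prod (x\<^sup>2) * (odd_euler_prod x * odd_euler_prod x))) UNIV"
  proof (rule jacobi_triple[OF x2])
    have 1: "1 - inverse x * (x\<^sup>2) ^ Suc k = 1 - x * (x\<^sup>2) ^ k"
      and 2: "1 - inverse (inverse x) * (x\<^sup>2) ^ k = 1 - x * (x\<^sup>2) ^ k" for k
      using x by (simp_all add: power2_eq_square)
    show "(\<lambda>m. (\<Prod>k<m. 1 - inverse x * (x\<^sup>2) ^ Suc k) * (\<Prod>k<m. 1 - inverse (inverse x) * (x\<^sup>2) ^ k))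
        \<longlonglongrightarrow> odd_euler_prod x * odd_euler_prod x"
      unfolding 1 2 by (intro tendsto_mult odd_euler_prod_LIMSEQ x)
  qed (use x in simp)
  also have "(\<lambda>k::int. (-1) powi k * (x\<^sup>2) powi tri k * inverse x powi k) = (\<lambda>k. (-1) powi k * x powi k\<^sup>2)"
  proof
    fix k :: int
    have "(x\<^sup>2) powi tri k * inverse x powi k = x powi (2 * tri k) * x powi (- k)"
      by (simp add: power_powi inverse_powi)
    also have "\<dots> = x powi (2 * tri k - k)"
      using x by (simp add: power_int_add[symmetric])
    also have "2 * tri k - k = k\<^sup>2"
      using two_tri[of k] by (simp add: power2_eq_square algebra_simps)
    finally show "(-1) powi k * (x\<^sup>2) powi tri k * inverse x powi k = (-1) powi k * x powi k\<^sup>2"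
      by (simp add: mult.assoc)
  qed
  also have "euler_prod (x\<^sup>2) * (odd_euler_prod x * odd_euler_prod x) = euler_prod x ^ 2 / euler_prod (x\<^sup>2)"
    unfolding odd_even_euler_prod[OF x(1), symmetric] using euler_prod_nz[OF x2(1)]
    by (simp add: power2_eq_square mult_ac)
  finally show ?thesis .
qed

text \<open>The triple product in base x^3 at z = 1/x: its factors have exponents 2 and 1 modulo 3,
  and multiplying by \<open>qfac (x ^ 3) m\<close> supplies the multiples of 3.\<close>

theorem euler_pentagonal:
  fixes x :: complex
  assumes x: "norm x < 1" "x \<noteq> 0"
  shows "((\<lambda>k::int. (-1) powi k * x powi (3 * tri k - k)) has_sum euler_prod x) UNIV"
proof -
  have x3: "norm (x ^ 3) < 1" "x ^ 3 \<noteq> 0" using x norm_power_less_one[of x 3] by auto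
  define P where "P m = (\<Prod>k<m. 1 - inverse x * (x ^ 3) ^ Suc k) * (\<Prod>k<m. 1 - inverse (inverse x) * (x ^ 3) ^ k)" for m
  have "qfac x (3 * m) = P m * qfac (x ^ 3) m" for m
  proof (induction m)
    case (Suc m)
    have "inverse x * (x ^ 3) ^ Suc m = x ^ Suc (Suc (3 * m))"
      using x by (simp add: power_mult power3_eq_cube)
    moreover have "inverse (inverse x) * (x ^ 3) ^ m = x ^ Suc (3 * m)"
      by (simp add: power_mult)
    moreover have "(x ^ 3) ^ Suc m = x ^ Suc (Suc (Suc (3 * m)))"
      by (simp add: power_mult power3_eq_cube)
    moreover have "3 * Suc m = Suc (Suc (Suc (3 * m)))" by simp
    ultimately show ?case
      using Suc.IH by (simp only: P_def prod.lessThan_Suc qfac_Suc mult_ac)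
  qed (simp add: P_def qfac_def)
  then have P: "P m = qfac x (3 * m) / qfac (x ^ 3) m" for m
    using qfac_nz[OF x3(1), of m] by (simp add: field_simps)
  have lim: "P \<longlonglongrightarrow> euler_prod x / euler_prod (x ^ 3)"
    unfolding P using x x3 euler_prod_nz[OF x3(1)]
    by (intro tendsto_divide qfac_LIMSEQ filterlim_compose[OF qfac_LIMSEQ[OF x(1)]] filterlim_subseq)
       (auto simp: strict_mono_def)
  have "((\<lambda>k::int. (-1) powi k * (x ^ 3) powi tri k * inverse x powi k) has_sum
      (euler_prod (x ^ 3) * (euler_prod x / euler_prod (x ^ 3)))) UNIV"
    using lim x unfolding P_def by (intro jacobi_triple[OF x3]) auto
  also have "(\<lambda>k::int. (-1) powi k * (x ^ 3) powi tri k * inverse x powi k)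
      = (\<lambda>k. (-1) powi k * x powi (3 * tri k - k))"
    using x by (simp add: power_powi inverse_powi power_int_add[symmetric] mult.assoc)
  finally show ?thesis using euler_prod_nz[OF x3(1)] by simp
qed

lemma has_sum_antisymmetric:
  fixes f :: "int \<Rightarrow> complex"
  assumes f: "f summable_on UNIV" and anti: "\<And>k. f (c - k) = - f k"
  shows "(f has_sum 0) UNIV"
proof -
  have s: "(f has_sum infsum f UNIV) UNIV" using f by simp
  then have "((\<lambda>k. f (c - k)) has_sum infsum f UNIV) UNIV"
    by (subst has_sum_reindex_bij_witness[of UNIV "\<lambda>k. c - k" "\<lambda>k. c - k" UNIV f]) auto
  moreover have "((\<lambda>k. f (c - k)) has_sum - infsum f UNIV) UNIV"
    unfolding anti using s by (rule has_sum_uminusI)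
  ultimately have "infsum f UNIV = - infsum f UNIV"
    by (rule has_sum_unique)
  then have "infsum f UNIV = 0" by simp
  then show ?thesis using s by simp
qed

lemma summable_theta_scaled:
  fixes x w :: complex
  assumes "norm x < 1" "w \<noteq> 0"
  shows "(\<lambda>k::int. (of_int a * of_int k + of_int b) * (x powi tri k * w powi k)) summable_on UNIV"
proof -
  have "(-1) powi k * x powi tri k * (- w) powi k = x powi tri k * w powi k" for k
    using power_int_mult_distrib[of "-1" "- w" k] by (simp add: mult_ac)
  note s = summable_theta[OF assms(1), of "- w", unfolded this]
  have "(\<lambda>k::int. of_int a * (of_int k * (x powi tri k * w powi k)) + of_int b * (x powi tri k * w powi k))
      summable_on UNIV"
    using s assms(2) by (intro summable_on_add summable_on_cmult_right) simp_all
  then show ?thesis by (simp add: algebra_simps)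
qed

section \<open>The differentiated quintuple product\<close>

text \<open>The product of the two triple products in the quintuple product identity, with the
  operator \<open>z d/dz\<close> applied. The terms with \<open>i - j\<close> in a fixed class modulo 3 factor again as a
  product of two series; the class 1 contributes 0.\<close>

theorem quintuple_derivative:
  fixes x z :: complex
  assumes x: "norm x < 1" "x \<noteq> 0" and z: "z \<noteq> 0"
    and A0: "((\<lambda>i::int. (-1) powi i * x powi tri i * z powi i) has_sum A0) UNIV"
    and A1: "((\<lambda>i::int. of_int i * ((-1) powi i * x powi tri i * z powi i)) has_sum A1) UNIV"
    and B0: "((\<lambda>j::int. (-1) powi j * x powi j\<^sup>2 * z powi (2 * j)) has_sum B0) UNIV"
    and B1: "((\<lambda>j::int. of_int j * ((-1) powi j * x powi j\<^sup>2 * z powi (2 * j))) has_sum B1) UNIV"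
  obtains s t where
    "((\<lambda>m::int. of_int (3 * m) * (x powi (3 * tri m - m) * z powi (3 * m))) has_sum s) UNIV"
    "((\<lambda>m::int. of_int (3 * m + 1) * (x powi (3 * tri m - m) * z powi (- 3 * m - 1))) has_sum t) UNIV"
    "(s + t) * euler_prod (x\<^sup>2) = A1 * B0 + 2 * A0 * B1"
proof -
  let ?a = "\<lambda>i::int. (-1) powi i * x powi tri i * z powi i"
  let ?b = "\<lambda>j::int. (-1) powi j * x powi j\<^sup>2 * z powi (2 * j)"
  define T where "T = (\<lambda>(i, j). of_int (i + 2 * j) * (?a i * ?b j))"
  \<comment> \<open>The operator z d/dz multiplies z^(i+2j) by i + 2j; splitting this weight is the
    product rule.\<close>
  have "((\<lambda>ij. (case ij of (i, j) \<Rightarrow> of_int i * ?a i * ?b j) + 2 * (case ij of (i, j) \<Rightarrow> ?a i * (of_int j * ?b j)))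
      has_sum (A1 * B0 + 2 * (A0 * B1))) (UNIV \<times> UNIV)"
    by (intro has_sum_add has_sum_cmult_right has_sum_Times_mult A0 A1 B0 B1)
  also have "(\<lambda>ij. (case ij of (i, j) \<Rightarrow> of_int i * ?a i * ?b j) + 2 * (case ij of (i, j) \<Rightarrow> ?a i * (of_int j * ?b j))) = T"
    by (auto simp: T_def algebra_simps)
  finally have T: "(T has_sum (A1 * B0 + 2 * A0 * B1)) UNIV" by (simp add: mult.assoc)

  have T_eq: "T (i, j) = of_int (i + 2 * j) * ((-1) powi (i + j) * (x powi (tri i + j\<^sup>2) * z powi (i + 2 * j)))" for i j
    using x z by (simp add: T_def power_int_add mult_ac)
  define S where "S r = {(i, j). (i - j) mod 3 = (r :: int)}" for r
  have Ssum: "T summable_on S r" for r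
    using T has_sum_imp_summable summable_on_subset_banach by blast

  define w where "w m = 3 * tri m - m" for m
  have two_w: "2 * w m = 3 * m\<^sup>2 + m" for m
    using two_tri[of m] by (simp add: w_def power2_eq_square algebra_simps)
  have w_powi: "x powi w m = (x ^ 3) powi tri m * inverse x powi m" for m
    using x by (simp add: w_def power_powi inverse_powi power_int_add[symmetric])
  have x3: "norm (x ^ 3) < 1" using x norm_power_less_one[of x 3] by auto
  have x2: "norm (x\<^sup>2) < 1" "x\<^sup>2 \<noteq> 0" using x norm_power_less_one[of x 2] by auto
  have x6: "norm (x ^ 6) < 1" using x norm_power_less_one[of x 6] by auto

  \<comment> \<open>In each class of i - j modulo 3 an affine substitution for (i, j) diagonalises
    \<open>tri i\<close> + j^2. The \<open>?u\<close> series in m carry the weight and the powers of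
    z, the \<open>?v\<close> series in l only signs and powers of x.\<close>
  let ?u0 = "\<lambda>m::int. of_int (3 * m) * (x powi w m * z powi (3 * m))"
  let ?u1 = "\<lambda>m::int. of_int (3 * m + 1) * (- (x powi (w m + m + 1) * z powi (3 * m + 1)))"
  let ?u2 = "\<lambda>m::int. of_int (3 * m + 1) * (x powi w m * z powi (- 3 * m - 1))"
  let ?v = "\<lambda>l::int. (-1) powi l * x powi (3 * l\<^sup>2 + l)"
  let ?v1 = "\<lambda>l::int. (-1) powi l * x powi (3 * l\<^sup>2 - 3 * l)"

  have "?u0 = (\<lambda>m. (of_int 3 * of_int m + of_int 0) * ((x ^ 3) powi tri m * (inverse x * z ^ 3) powi m))"
    by (simp add: w_powi power_int_mult_distrib power_powi mult_ac)
  then have u0: "?u0 summable_on UNIV"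
    using summable_theta_scaled[OF x3, of "inverse x * z ^ 3" 3 0] x z by simp
  have "?u2 = (\<lambda>m. inverse z * ((of_int 3 * of_int m + of_int 1) * ((x ^ 3) powi tri m * (inverse x * inverse z ^ 3) powi m)))"
    using z by (simp add: w_powi power_int_mult_distrib inverse_powi power_powi power_int_diff divide_inverse mult_ac
        flip: power_inverse)
  then have u2: "?u2 summable_on UNIV"
    using summable_theta_scaled[OF x3, of "inverse x * inverse z ^ 3" 3 1] x z
    by (simp add: summable_on_cmult_right)
  have "?u1 = (\<lambda>m. - x * z * ((of_int 3 * of_int m + of_int 1) * ((x ^ 3) powi tri m * (z ^ 3) powi m)))"
    using x z by (simp add: w_powi power_powi power_int_add inverse_powi power_int_minus field_simps)
  then have u1: "?u1 summable_on UNIV"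
    using summable_theta_scaled[OF x3, of "z ^ 3" 3 1] z
    by (simp only:) (intro summable_on_cmult_right, simp)

  have v: "(?v has_sum euler_prod (x\<^sup>2)) UNIV"
  proof -
    have "int 2 * (3 * tri l - l) = 3 * l\<^sup>2 + l" for l
      using two_w[of l] by (simp add: w_def)
    then have "(x\<^sup>2) powi (3 * tri l - l) = x powi (3 * l\<^sup>2 + l)" for l
      by (simp only: power_powi)
    then show ?thesis using euler_pentagonal[OF x2] by simp
  qed
  \<comment> \<open>The reflection l -> 1 - l fixes the exponent and flips the sign, so class 1
    contributes 0.\<close>
  have v1: "(?v1 has_sum 0) UNIV"
  proof (rule has_sum_antisymmetric[where c = 1])
    have "6 * tri l - 6 * l = 3 * l\<^sup>2 - 3 * l" for l
      using two_tri[of l] by (simp add: power2_eq_square algebra_simps)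
    moreover have "(x ^ 6) powi tri l * (inverse x ^ 6) powi l = x powi (6 * tri l - 6 * l)" for l
      using x by (simp add: power_powi inverse_powi power_int_add[symmetric] flip: power_inverse)
    ultimately have "x powi (3 * l\<^sup>2 - 3 * l) = (x ^ 6) powi tri l * (inverse x ^ 6) powi l" for l
      by simp
    then show "?v1 summable_on UNIV"
      using summable_theta(2)[OF x6, of "inverse x ^ 6"] x by (simp add: mult_ac)
    show "?v1 (1 - k) = - ?v1 k" for k
    proof -
      have "3 * (1 - k)\<^sup>2 - 3 * (1 - k) = 3 * k\<^sup>2 - 3 * k"
        by (simp add: power2_eq_square algebra_simps)
      then show ?thesis by (simp only: neg_one_powi) simp
    qed
  qed

  have xpow: "x powi (a + b) = x powi a * x powi b" for a b
    using x by (intro power_int_add) simp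
  \<comment> \<open>Every member of class r has the form (j + 3d + r, j), so surjectivity follows
    from hitting these pairs.\<close>
  have bijI: "bij_betw \<phi> UNIV (S r)"
    if "inj \<phi>" "\<And>ml. \<phi> ml \<in> S r" "\<And>j d. \<exists>ml. \<phi> ml = (j + 3 * d + r, j)" for \<phi> r
  proof -
    have "ij \<in> range \<phi>" if ij_S: "ij \<in> S r" for ij
    proof -
      obtain i j where ij: "ij = (i, j)" "(i - j) mod 3 = r" using ij_S by (auto simp: S_def)
      then have "i = j + 3 * ((i - j) div 3) + r" by presburger
      moreover obtain ml where "\<phi> ml = (j + 3 * ((i - j) div 3) + r, j)"
        using \<open>\<And>j d. \<exists>ml. \<phi> ml = (j + 3 * d + r, j)\<close> by blast
      ultimately show ?thesis using ij(1) by (metis rangeI)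
    qed
    then show ?thesis using that by (auto simp: bij_betw_def)
  qed
  have class_sum: "(T has_sum infsum u UNIV * c) (S r)"
    if "bij_betw \<phi> UNIV (S r)" and "\<And>m l. T (\<phi> (m, l)) = u m * v l"
      and "u summable_on UNIV" and "(v has_sum c) UNIV" for \<phi> u v c r
  proof -
    have "((\<lambda>(m, l). u m * v l) has_sum infsum u UNIV * c) (UNIV \<times> UNIV)"
      using that by (intro has_sum_Times_mult) auto
    moreover have "(\<lambda>ml. T (\<phi> ml)) = (\<lambda>(m, l). u m * v l)"
      using that(2) by auto
    ultimately have "((\<lambda>ml. T (\<phi> ml)) has_sum infsum u UNIV * c) UNIV"
      by simp
    then show ?thesis
      using has_sum_reindex_bij_betw[OF that(1)] by blast
  qed
  have S0: "(T has_sum infsum ?u0 UNIV * euler_prod (x\<^sup>2)) (S 0)"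
  proof (rule class_sum[OF _ _ u0 v])
    show "bij_betw (\<lambda>(m, l). (m + 2 * l, m - l)) UNIV (S 0)"
    proof (rule bijI)
      show "(case ml of (m, l) \<Rightarrow> (m + 2 * l, m - l)) \<in> S 0" for ml
        unfolding S_def by (cases ml) (simp only: prod.case mem_Collect_eq, presburger)
      show "\<exists>ml. (case ml of (m, l) \<Rightarrow> (m + 2 * l, m - l)) = (j + 3 * d + 0, j)" for j d :: int
        by (rule exI[of _ "(j + d, d)"]) simp
    qed (auto simp: inj_def)
    fix m l :: int
    \<comment> \<open>The exponent has no cross term in m and l, the sign depends on l alone, and i
      + 2j on m alone.\<close>
    have e: "tri (m + 2 * l) + (m - l)\<^sup>2 = w m + (3 * l\<^sup>2 + l)"
      using two_tri[of "m + 2 * l"] two_w[of m] by (simp add: power2_eq_square algebra_simps)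
    have f: "(-1 :: complex) powi (m + 2 * l + (m - l)) = (-1) powi l"
      by (rule neg_one_powi_eqI) simp
    have g: "m + 2 * l + 2 * (m - l) = 3 * m" by simp
    show "T (case (m, l) of (m, l) \<Rightarrow> (m + 2 * l, m - l)) = ?u0 m * ?v l"
      unfolding prod.case T_eq e f g xpow by (simp only: mult_ac)
  qed
  have S1: "(T has_sum infsum ?u1 UNIV * 0) (S 1)"
  proof (rule class_sum[OF _ _ u1 v1])
    show "bij_betw (\<lambda>(m, l). (m - 2 * l + 1, m + l)) UNIV (S 1)"
    proof (rule bijI)
      show "(case ml of (m, l) \<Rightarrow> (m - 2 * l + 1, m + l)) \<in> S 1" for ml
        unfolding S_def by (cases ml) (simp only: prod.case mem_Collect_eq, presburger)
      show "\<exists>ml. (case ml of (m, l) \<Rightarrow> (m - 2 * l + 1, m + l)) = (j + 3 * d + 1, j)" for j d :: int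
        by (rule exI[of _ "(j + d, - d)"]) simp
    qed (auto simp: inj_def)
    fix m l :: int
    have e: "tri (m - 2 * l + 1) + (m + l)\<^sup>2 = (w m + m + 1) + (3 * l\<^sup>2 - 3 * l)"
      using two_tri[of "m - 2 * l + 1"] two_w[of m] by (simp add: power2_eq_square algebra_simps)
    have f: "(-1 :: complex) powi (m - 2 * l + 1 + (m + l)) = - ((-1) powi l)"
      by (simp add: neg_one_powi)
    have g: "m - 2 * l + 1 + 2 * (m + l) = 3 * m + 1" by simp
    show "T (case (m, l) of (m, l) \<Rightarrow> (m - 2 * l + 1, m + l)) = ?u1 m * ?v1 l"
      unfolding prod.case T_eq e f g xpow by (simp only: mult_minus_left mult_minus_right mult_ac)
  qed
  have S2: "(T has_sum infsum ?u2 UNIV * euler_prod (x\<^sup>2)) (S 2)"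
  proof (rule class_sum[OF _ _ u2 v])
    show "bij_betw (\<lambda>(m, l). (- m - 2 * l - 1, l - m)) UNIV (S 2)"
    proof (rule bijI)
      show "(case ml of (m, l) \<Rightarrow> (- m - 2 * l - 1, l - m)) \<in> S 2" for ml
        unfolding S_def by (cases ml) (simp only: prod.case mem_Collect_eq, presburger)
      show "\<exists>ml. (case ml of (m, l) \<Rightarrow> (- m - 2 * l - 1, l - m)) = (j + 3 * d + 2, j)" for j d :: int
        by (rule exI[of _ "(- d - 1 - j, - d - 1)"]) simp
    qed (auto simp: inj_def)
    fix m l :: int
    have e: "tri (- m - 2 * l - 1) + (l - m)\<^sup>2 = w m + (3 * l\<^sup>2 + l)"
      using two_tri[of "- m - 2 * l - 1"] two_w[of m] by (simp add: power2_eq_square algebra_simps)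
    have f: "(-1 :: complex) powi (- m - 2 * l - 1 + (l - m)) = - ((-1) powi l)"
      by (simp add: neg_one_powi)
    have g: "- m - 2 * l - 1 + 2 * (l - m) = - 3 * m - 1" by simp
    \<comment> \<open>This minus cancels the one in the sign \<open>f\<close>, leaving the weight 3m
      + 1.\<close>
    have "of_int (- 3 * m - 1) = - (of_int (3 * m + 1) :: complex)" by simp
    then show "T (case (m, l) of (m, l) \<Rightarrow> (- m - 2 * l - 1, l - m)) = ?u2 m * ?v l"
      unfolding prod.case T_eq e f g xpow by (simp only: mult_minus_left mult_minus_right minus_minus mult_ac)
  qed

  have "(T has_sum (infsum ?u0 UNIV * euler_prod (x\<^sup>2) + infsum ?u1 UNIV * 0 + infsum ?u2 UNIV * euler_prod (x\<^sup>2))) (S 0 \<union> S 1 \<union> S 2)"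
    by (intro has_sum_Un_disjoint S0 S1 S2) (auto simp: S_def)
  moreover have "S 0 \<union> S 1 \<union> S 2 = UNIV"
    unfolding S_def by auto
  ultimately have "(infsum ?u0 UNIV + infsum ?u2 UNIV) * euler_prod (x\<^sup>2) = A1 * B0 + 2 * A0 * B1"
    using has_sum_unique[OF T] by (simp add: algebra_simps)
  then show ?thesis
    using u0 u2 by (intro that[of "infsum ?u0 UNIV" "infsum ?u2 UNIV"]) (auto simp: w_def)
qed

text \<open>The reflection k -> -1 - k fixes \<open>tri\<close> and reverses the sign.\<close>

lemma sum_theta_alternating_tri:
  fixes x :: complex
  assumes "norm x < 1"
  shows "((\<lambda>k::int. (-1) powi k * x powi tri k) has_sum 0) UNIV"
proof (rule has_sum_antisymmetric[where c = "-1"])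
  show "(\<lambda>k::int. (-1) powi k * x powi tri k) summable_on UNIV"
    using summable_theta(2)[OF assms, of 1] by simp
  have "- 1 - k = - k - 1" for k :: int by simp
  then have "tri (- 1 - k) = tri k" for k by (simp only: tri_minus)
  then show "(-1) powi (- 1 - k) * x powi tri (- 1 - k) = - ((-1) powi k * x powi tri k)" for k
    by (simp add: neg_one_powi)
qed

lemma square_powi_tri:
  assumes "x \<noteq> 0"
  shows "(x\<^sup>2) powi tri k * inverse x powi k = (x :: complex) powi k\<^sup>2"
proof -
  have "2 * tri k + - k = k\<^sup>2" using two_tri[of k] by (simp add: power2_eq_square algebra_simps)
  then show ?thesis
    using assms by (simp add: power_powi inverse_powi power_int_add[symmetric])
qed

text \<open>At z = 1 the undifferentiated triangular series vanishes, so only Jacobi's cube times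
  Gauss's series remains. The weights 3m and 3m + 1 add to 6m + 1.\<close>

theorem sum_linear_pentagonal:
  fixes x :: complex
  assumes x: "norm x < 1" "x \<noteq> 0"
  shows "((\<lambda>m::int. of_int (6 * m + 1) * x powi (3 * tri m - m)) has_sum
    euler_prod x ^ 5 / euler_prod (x\<^sup>2) ^ 2) UNIV"
proof -
  have x2: "norm (x\<^sup>2) < 1" using x norm_power_less_one[of x 2] by auto
  have B1: "(\<lambda>j::int. of_int j * ((-1) powi j * x powi j\<^sup>2)) summable_on UNIV"
    using summable_theta(1)[OF x2, of "inverse x"] x square_powi_tri[OF x(2)] by (simp add: mult.assoc)
  obtain s t where
    s: "((\<lambda>m::int. of_int (3 * m) * (x powi (3 * tri m - m) * 1 powi (3 * m))) has_sum s) UNIV"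
    and t: "((\<lambda>m::int. of_int (3 * m + 1) * (x powi (3 * tri m - m) * 1 powi (- 3 * m - 1))) has_sum t) UNIV"
    and st: "(s + t) * euler_prod (x\<^sup>2) = euler_prod x ^ 3 * (euler_prod x ^ 2 / euler_prod (x\<^sup>2))
      + 2 * 0 * (\<Sum>\<^sub>\<infinity>j::int. of_int j * ((-1) powi j * x powi j\<^sup>2))"
  proof (rule quintuple_derivative[OF x, of 1])
    show "((\<lambda>i::int. (-1) powi i * x powi tri i * 1 powi i) has_sum 0) UNIV"
      using sum_theta_alternating_tri[OF x(1)] by simp
    show "((\<lambda>i::int. of_int i * ((-1) powi i * x powi tri i * 1 powi i)) has_sum euler_prod x ^ 3) UNIV"
      using jacobi_cube[OF x] by simp
    show "((\<lambda>j::int. (-1) powi j * x powi j\<^sup>2 * 1 powi (2 * j)) has_sum euler_prod x ^ 2 / euler_prod (x\<^sup>2)) UNIV"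
      using gauss_square_theta[OF x] by simp
    show "((\<lambda>j::int. of_int j * ((-1) powi j * x powi j\<^sup>2 * 1 powi (2 * j))) has_sum
        (\<Sum>\<^sub>\<infinity>j::int. of_int j * ((-1) powi j * x powi j\<^sup>2))) UNIV"
      using B1 by simp
  qed auto
  have "((\<lambda>m::int. of_int (3 * m) * (x powi (3 * tri m - m) * 1 powi (3 * m))
      + of_int (3 * m + 1) * (x powi (3 * tri m - m) * 1 powi (- 3 * m - 1))) has_sum (s + t)) UNIV"
    by (rule has_sum_add[OF s t])
  also have "(\<lambda>m::int. of_int (3 * m) * (x powi (3 * tri m - m) * 1 powi (3 * m))
      + of_int (3 * m + 1) * (x powi (3 * tri m - m) * 1 powi (- 3 * m - 1)))
    = (\<lambda>m::int. of_int (6 * m + 1) * x powi (3 * tri m - m))"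
    by (simp add: algebra_simps)
  also have "s + t = euler_prod x ^ 5 / euler_prod (x\<^sup>2) ^ 2"
    using st euler_prod_nz[OF x2] by (simp add: field_simps power2_eq_square eval_nat_numeral)
  finally show ?thesis .
qed

text \<open>At x = y^2, z = y the roles are reversed: the second triple product becomes the
  alternating triangular series in base y^4, which vanishes and whose derivative is Jacobi's
  cube.\<close>

theorem sum_linear_octagonal:
  fixes y :: complex
  assumes y: "norm y < 1" "y \<noteq> 0"
  shows "((\<lambda>m::int. of_int (3 * m + 1) * y powi (3 * m\<^sup>2 + 2 * m)) has_sum
    euler_prod y ^ 2 * euler_prod (y ^ 4) ^ 2 / euler_prod (y\<^sup>2)) UNIV"
proof -
  have y2: "norm (y\<^sup>2) < 1" "y\<^sup>2 \<noteq> 0" using y norm_power_less_one[of y 2] by auto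
  have y4: "norm (y ^ 4) < 1" "y ^ 4 \<noteq> 0" using y norm_power_less_one[of y 4] by auto
  have ypow: "y powi (a + b) = y powi a * y powi b" for a b
    using y by (intro power_int_add) simp
  define \<theta> where "\<theta> = euler_prod y ^ 2 / euler_prod (y\<^sup>2)"
  have b_eq: "(-1) powi j * (y\<^sup>2) powi j\<^sup>2 * y powi (2 * j) = (-1) powi j * (y ^ 4) powi tri j" for j
  proof -
    have "int 4 * tri j = int 2 * j\<^sup>2 + 2 * j"
      using two_tri[of j] by (simp add: power2_eq_square algebra_simps)
    then have "(y ^ 4) powi tri j = (y\<^sup>2) powi j\<^sup>2 * y powi (2 * j)"
      by (simp only: power_powi ypow)
    then show ?thesis by simp
  qed
  have A0: "((\<lambda>i::int. (-1) powi i * (y\<^sup>2) powi tri i * y powi i) has_sum - inverse y * \<theta>) UNIV"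
  proof -
    \<comment> \<open>Since i(i + 1) + i = (i + 1)^2 - 1, the series is Gauss's with the index
      shifted by one, which costs the factor -1/y.\<close>
    have "((\<lambda>k::int. - inverse y * ((-1) powi k * y powi k\<^sup>2)) has_sum - inverse y * \<theta>) UNIV"
      using gauss_square_theta[OF y] unfolding \<theta>_def by (rule has_sum_cmult_right)
    then show ?thesis
    proof (subst has_sum_reindex_bij_witness[of UNIV "\<lambda>k. k - 1" "\<lambda>i. i + 1" UNIV
        "\<lambda>k::int. - inverse y * ((-1) powi k * y powi k\<^sup>2)"])
      fix i :: int
      have e: "(i + 1)\<^sup>2 = (int 2 * tri i + i) + 1"
        using two_tri[of i] by (simp add: power2_eq_square algebra_simps)
      show "- inverse y * ((-1) powi (i + 1) * y powi (i + 1)\<^sup>2) = (-1) powi i * (y\<^sup>2) powi tri i * y powi i"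
        unfolding e power_powi ypow using y by (simp add: neg_one_powi)
    qed auto
  qed
  have A1: "(\<lambda>i::int. of_int i * ((-1) powi i * (y\<^sup>2) powi tri i * y powi i)) summable_on UNIV"
    by (rule summable_theta(1)[OF y2(1) y(2)])
  obtain s t where
    s: "((\<lambda>m::int. of_int (3 * m) * ((y\<^sup>2) powi (3 * tri m - m) * y powi (3 * m))) has_sum s) UNIV"
    and t: "((\<lambda>m::int. of_int (3 * m + 1) * ((y\<^sup>2) powi (3 * tri m - m) * y powi (- 3 * m - 1))) has_sum t) UNIV"
    and st: "(s + t) * euler_prod ((y\<^sup>2)\<^sup>2) = (\<Sum>\<^sub>\<infinity>i::int. of_int i * ((-1) powi i * (y\<^sup>2) powi tri i * y powi i)) * 0
      + 2 * (- inverse y * \<theta>) * euler_prod (y ^ 4) ^ 3"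
  proof (rule quintuple_derivative[OF y2 y(2) A0])
    show "((\<lambda>j::int. (-1) powi j * (y\<^sup>2) powi j\<^sup>2 * y powi (2 * j)) has_sum 0) UNIV"
      unfolding b_eq by (rule sum_theta_alternating_tri[OF y4(1)])
    show "((\<lambda>j::int. of_int j * ((-1) powi j * (y\<^sup>2) powi j\<^sup>2 * y powi (2 * j))) has_sum euler_prod (y ^ 4) ^ 3) UNIV"
      unfolding b_eq by (rule jacobi_cube[OF y4])
    show "((\<lambda>i::int. of_int i * ((-1) powi i * (y\<^sup>2) powi tri i * y powi i)) has_sum
        (\<Sum>\<^sub>\<infinity>i::int. of_int i * ((-1) powi i * (y\<^sup>2) powi tri i * y powi i))) UNIV"
      using A1 by simp
  qed auto
  \<comment> \<open>The reflections m = -n - 1 here and m = -n for \<open>t\<close> bring both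
    series to the exponent 3n^2 + 2n - 1.\<close>
  have s': "((\<lambda>n::int. of_int (- 3 * n - 3) * (y powi (3 * n\<^sup>2 + 2 * n) * y powi - 1)) has_sum s) UNIV"
  proof (subst has_sum_reindex_bij_witness[of UNIV "\<lambda>k. - k - 1" "\<lambda>i. - i - 1" UNIV
        "\<lambda>m::int. of_int (3 * m) * ((y\<^sup>2) powi (3 * tri m - m) * y powi (3 * m))"])
    fix n :: int
    have e: "int 2 * (3 * tri (- n - 1) - (- n - 1)) + 3 * (- n - 1) = (3 * n\<^sup>2 + 2 * n) + - 1"
      using two_tri[of "- n - 1"] by (simp add: power2_eq_square algebra_simps)
    have c: "3 * (- n - 1) = - 3 * n - 3" by simp
    show "of_int (3 * (- n - 1)) * ((y\<^sup>2) powi (3 * tri (- n - 1) - (- n - 1)) * y powi (3 * (- n - 1)))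
        = of_int (- 3 * n - 3) * (y powi (3 * n\<^sup>2 + 2 * n) * y powi - 1)"
      unfolding power_powi ypow[symmetric] e by (simp only: c)
  qed (use s in auto)
  have t': "((\<lambda>n::int. of_int (- 3 * n + 1) * (y powi (3 * n\<^sup>2 + 2 * n) * y powi - 1)) has_sum t) UNIV"
  proof (subst has_sum_reindex_bij_witness[of UNIV "\<lambda>k. - k" "\<lambda>i. - i" UNIV
        "\<lambda>m::int. of_int (3 * m + 1) * ((y\<^sup>2) powi (3 * tri m - m) * y powi (- 3 * m - 1))"])
    fix n :: int
    have e: "int 2 * (3 * tri (- n) - (- n)) + (- 3 * (- n) - 1) = (3 * n\<^sup>2 + 2 * n) + - 1"
      using two_tri[of "- n"] by (simp add: power2_eq_square algebra_simps)
    have c: "3 * (- n) + 1 = - 3 * n + 1" by simp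
    show "of_int (3 * (- n) + 1) * ((y\<^sup>2) powi (3 * tri (- n) - (- n)) * y powi (- 3 * (- n) - 1))
        = of_int (- 3 * n + 1) * (y powi (3 * n\<^sup>2 + 2 * n) * y powi - 1)"
      unfolding power_powi ypow[symmetric] e by (simp only: c)
  qed (use t in auto)
  \<comment> \<open>The weights add to -2(3n + 1), and one factor 1/y is left over; hence the
    normalisation -y/2.\<close>
  have "((\<lambda>n::int. - y / 2 * (of_int (- 3 * n - 3) * (y powi (3 * n\<^sup>2 + 2 * n) * y powi - 1)
      + of_int (- 3 * n + 1) * (y powi (3 * n\<^sup>2 + 2 * n) * y powi - 1))) has_sum - y / 2 * (s + t)) UNIV"
    by (intro has_sum_cmult_right has_sum_add s' t')
  also have "(\<lambda>n::int. - y / 2 * (of_int (- 3 * n - 3) * (y powi (3 * n\<^sup>2 + 2 * n) * y powi - 1)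
      + of_int (- 3 * n + 1) * (y powi (3 * n\<^sup>2 + 2 * n) * y powi - 1)))
    = (\<lambda>n. of_int (3 * n + 1) * y powi (3 * n\<^sup>2 + 2 * n))"
  proof
    fix n :: int
    have "- y / 2 * (a * (P * y powi - 1) + b * (P * y powi - 1)) = - (a + b) / 2 * P" for a b P :: complex
      using y by (simp add: power_int_minus field_simps)
    then show "- y / 2 * (of_int (- 3 * n - 3) * (y powi (3 * n\<^sup>2 + 2 * n) * y powi - 1)
      + of_int (- 3 * n + 1) * (y powi (3 * n\<^sup>2 + 2 * n) * y powi - 1)) = of_int (3 * n + 1) * y powi (3 * n\<^sup>2 + 2 * n)"
      by (simp only:) simp
  qed
  also have "- y / 2 * (s + t) = \<theta> * euler_prod (y ^ 4) ^ 2"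
  proof -
    have "(s + t) * euler_prod (y ^ 4) = 2 * (- inverse y * \<theta>) * euler_prod (y ^ 4) ^ 2 * euler_prod (y ^ 4)"
      using st by (simp add: eval_nat_numeral mult_ac)
    then have "s + t = 2 * (- inverse y * \<theta>) * euler_prod (y ^ 4) ^ 2"
      using euler_prod_nz[OF y4(1)] by (simp only: mult_cancel_right) simp
    then show ?thesis using y by simp
  qed
  finally show ?thesis by (simp add: \<theta>_def)
qed

text \<open>The terms at n and -n - 1 share their power of x, and their coefficients combine to
  (-1)^n (2n + 1).\<close>

lemma jacobi_cube_nat:
  fixes x :: complex
  assumes x: "norm x < 1" "x \<noteq> 0"
  shows "((\<lambda>n::nat. (-1) ^ n * of_nat (2 * n + 1) * x ^ (n * (n + 1) div 2)) has_sum euler_prod x ^ 3) UNIV"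
proof -
  let ?f = "\<lambda>k::int. of_int k * ((-1) powi k * x powi tri k)"
  have f: "(?f has_sum euler_prod x ^ 3) UNIV" by (rule jacobi_cube[OF x])
  have sum: "(\<lambda>n. ?f (h n)) summable_on UNIV" if "inj h" for h :: "nat \<Rightarrow> int"
    using summable_on_reindex[OF that, of ?f] f has_sum_imp_summable
      summable_on_subset_banach[of ?f UNIV "range h"] by (auto simp: o_def)
  have 1: "((\<lambda>n. ?f (int n)) has_sum infsum (\<lambda>n. ?f (int n)) UNIV) UNIV"
    by (intro has_sum_infsum sum) (auto simp: inj_def)
  have 2: "((\<lambda>n. ?f (- int n - 1)) has_sum infsum (\<lambda>n. ?f (- int n - 1)) UNIV) UNIV"
    by (intro has_sum_infsum sum) (auto simp: inj_def)
  have "((\<lambda>n. ?f (int n) + ?f (- int n - 1)) has_sum euler_prod x ^ 3) UNIV"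
    using has_sum_add[OF 1 2] has_sum_unique[OF f has_sum_int_split[OF 1 2]] by simp
  moreover have "?f (int n) + ?f (- int n - 1) = (-1) ^ n * of_nat (2 * n + 1) * x ^ (n * (n + 1) div 2)" for n
    unfolding tri_minus powi_tri_of_nat by (simp add: neg_one_powi minus_one_power_iff algebra_simps)
  ultimately show ?thesis by simp
qed

section \<open>Eta quotients\<close>

text \<open>Passes from an unconditional sum over the support of the coefficients to the ordered
  series over n.\<close>

lemma sums_reindex:
  fixes f :: "nat \<Rightarrow> complex"
  assumes g: "(g has_sum s) UNIV" and h: "inj h"
    and eq: "\<And>m. f (h m) = g m" and zero: "\<And>n. n \<notin> range h \<Longrightarrow> f n = 0"
  shows "f sums s"
proof -
  have "(f has_sum s) (range h)"
    unfolding has_sum_reindex[OF h] using g eq by (simp add: o_def)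
  then have "(f has_sum s) UNIV"
    using has_sum_cong_neutral[of UNIV "range h" f f s] zero by auto
  then show ?thesis by (rule has_sum_imp_sums)
qed

lemma dedekind_eta_mult:
  "dedekind_eta (numeral w * \<tau>) =
    exp (2 * of_real pi * \<i> * \<tau> / 24) ^ numeral w * euler_prod (exp (2 * of_real pi * \<i> * \<tau>) ^ numeral w)"
proof -
  have 1: "2 * of_real pi * \<i> * (numeral w * \<tau>) / 24 = of_nat (numeral w) * (2 * of_real pi * \<i> * \<tau> / 24)"
    and 2: "2 * of_real pi * \<i> * (numeral w * \<tau>) = of_nat (numeral w) * (2 * of_real pi * \<i> * \<tau>)"
    by (simp_all only: of_nat_numeral times_divide_eq_right mult_ac)
  show ?thesis
    unfolding dedekind_eta_def euler_prod_def 1 unfolding 2 exp_of_nat_mult ..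
qed

text \<open>Used for 1 + 8 tri n = (2n + 1)^2, 1 + 3(3m^2 + 2m) = (3m + 1)^2 and 1 + 24 (3 tri m -
  m) = (6m + 1)^2.\<close>

lemma q_powi_complete_square:
  assumes "q \<noteq> 0" and "1 + int d * e = (int N)\<^sup>2"
  shows "q * (q ^ d) powi e = (q :: complex) ^ N\<^sup>2"
proof -
  have "q ^ N\<^sup>2 = q powi (1 + int d * e)"
    unfolding assms(2) by (simp only: of_nat_power[symmetric] power_int_of_nat)
  then show ?thesis using assms(1) by (simp add: power_int_add power_powi)
qed

section \<open>Signs of the exponents matched with characters\<close>

lemma even_pentagonal: "even (3 * tri m - m) \<longleftrightarrow> m mod 4 = 0 \<or> m mod 4 = 1"
proof -
  define a r where "a = m div 4" and "r = m mod 4"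
  have m: "m = 4 * a + r" by (simp add: a_def r_def)
  have "r \<in> {0..<4}" by (simp add: r_def)
  then have r: "r = 0 \<or> r = 1 \<or> r = 2 \<or> r = 3" by auto
  have "2 * (3 * tri m - m) = 2 * (2 * (12 * a * a + 6 * a * r + a)) + (3 * r * r + r)"
    using two_tri[of m] unfolding m by (simp add: algebra_simps)
  \<comment> \<open>The constants 0, 2, 7, 15 are (3 r^2 + r)/2 for r = 0, 1, 2, 3; the rest of the
    exponent is even.\<close>
  with r have b: "3 * tri m - m = 2 * (12 * a * a + 6 * a * r + a)
      + (if r = 0 then 0 else if r = 1 then 2 else if r = 2 then 7 else 15)"
    by auto
  show ?thesis using r unfolding r_def[symmetric] b by (elim disjE) auto
qed

lemma even_tri: "even (tri (int n)) \<longleftrightarrow> n mod 4 = 0 \<or> n mod 4 = 3"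
proof -
  define a r where "a = n div 4" and "r = n mod 4"
  have n: "n = 4 * a + r" by (simp add: a_def r_def)
  have "r \<in> {..<4}" by (simp add: r_def)
  then have r: "r = 0 \<or> r = 1 \<or> r = 2 \<or> r = 3" by auto
  have "2 * tri (int n) = 2 * (2 * (4 * int a * int a + 2 * int a * int r + int a)) + (int r * int r + int r)"
    using two_tri[of "int n"] unfolding n by (simp add: algebra_simps)
  with r have "\<exists>b. tri (int n) = 2 * b + (if r = 0 then 0 else if r = 1 then 1 else if r = 2 then 3 else 6)"
    by (intro exI[of _ "4 * int a * int a + 2 * int a * int r + int a"]) auto
  then show ?thesis using r unfolding r_def[symmetric] by (elim disjE) auto
qed

text \<open>Replacing x by -x in Jacobi's cube turns its sign (-1)^n into this product of signs;
  both sides depend on n modulo 4.\<close>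

lemma chi_m8_odd: "of_int (chi_m8 (2 * n + 1)) = (-1) ^ n * (-1 :: complex) powi tri (int n)"
proof -
  define a r where "a = n div 4" and "r = n mod 4"
  have n: "n = 4 * a + r" by (simp add: a_def r_def)
  have "r \<in> {..<4}" by (simp add: r_def)
  then have r: "r = 0 \<or> r = 1 \<or> r = 2 \<or> r = 3" by auto
  have "(2 * n + 1) mod 8 = (2 * r + 1) mod 8"
    unfolding n using mod_mult_self3[of a 8 "2 * r + 1"] by (simp add: algebra_simps)
  moreover have "even n \<longleftrightarrow> even r" by (simp add: n)
  ultimately show ?thesis
    using r unfolding neg_one_powi even_tri r_def[symmetric] minus_one_power_iff chi_m8_def
    by (elim disjE) simp_all
qed

text \<open>The character has period 24 in |6m + 1|, so each sign of m leaves four residues. For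
  negative m the character also absorbs the sign of 6m + 1.\<close>

lemma chi_24_pentagonal:
  "of_int (chi_m8 (nat \<bar>6 * m + 1\<bar>) * chi_12 (nat \<bar>6 * m + 1\<bar>)) * of_nat (nat \<bar>6 * m + 1\<bar>)
    = of_int (6 * m + 1) * (-1 :: complex) powi (3 * tri m - m)"
proof (cases "m \<ge> 0")
  case True
  define a r where "a = nat m div 4" and "r = nat m mod 4"
  have "nat m = 4 * a + r" by (simp add: a_def r_def)
  then have m: "m = 4 * int a + int r" using True by linarith
  have "r \<in> {..<4}" by (simp add: r_def)
  then have r: "r = 0 \<or> r = 1 \<or> r = 2 \<or> r = 3" by auto
  have "nat \<bar>6 * m + 1\<bar> = 24 * a + (6 * r + 1)" unfolding m by simp
  note N = this
  have "m mod 4 = int r" using r unfolding m by auto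
  then show ?thesis
    using r unfolding N neg_one_powi even_pentagonal chi_24
    by (elim disjE) (simp_all add: chi_m8_def chi_12_def m)
next
  case False
  \<comment> \<open>With m = -k - 1 one has |6m + 1| = 6k + 5.\<close>
  define k where "k = nat (- m - 1)"
  define a r where "a = k div 4" and "r = k mod 4"
  have "k = 4 * a + r" by (simp add: a_def r_def)
  then have m: "m = - 4 * int a - int r - 1" using False unfolding k_def by linarith
  have "r \<in> {..<4}" by (simp add: r_def)
  then have r: "r = 0 \<or> r = 1 \<or> r = 2 \<or> r = 3" by auto
  have "nat \<bar>6 * m + 1\<bar> = 24 * a + (6 * r + 5)" unfolding m by simp
  note N = this
  have "m mod 4 = 3 - int r"
    using r unfolding m by (elim disjE) (simp_all, presburger+)
  then show ?thesis
    using r unfolding N neg_one_powi even_pentagonal chi_24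
    by (elim disjE) (simp_all add: chi_m8_def chi_12_def m)
qed

text \<open>For m < 0 the absolute value is 2 modulo 3, so the symbol restores the lost
  sign.\<close>

lemma kronecker_3_abs: "of_int (kronecker (int (nat \<bar>3 * m + 1\<bar>)) 3) * of_nat (nat \<bar>3 * m + 1\<bar>) = (of_int (3 * m + 1) :: complex)"
proof (cases "m \<ge> 0")
  case True
  then have "\<bar>3 * m + 1\<bar> = 3 * m + 1" by simp
  moreover have "(3 * m + 1) mod 3 = 1" by presburger
  ultimately show ?thesis using True by (simp add: kronecker_3)
next
  case False
  then have "\<bar>3 * m + 1\<bar> = - 3 * m - 1" by simp
  moreover have "(- 3 * m - 1) mod 3 = 2" by presburger
  ultimately show ?thesis using False by (simp add: kronecker_3)
qed

lemma Suc_nat_abs_linear: "Suc (nat \<bar>3 * m + 1\<bar> - 1) = nat \<bar>3 * m + 1\<bar>" for m :: int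
proof -
  have "3 * m + 1 \<noteq> 0" by presburger
  then show ?thesis by simp
qed

text \<open>3m + 1 is 1 modulo 3 and -(3n + 1) is 2 modulo 3, so absolute values collide only for m
  = n.\<close>

lemma inj_nat_abs_linear: "inj (\<lambda>m::int. nat \<bar>3 * m + 1\<bar> - 1)"
proof (rule injI)
  fix m n :: int
  assume "nat \<bar>3 * m + 1\<bar> - 1 = nat \<bar>3 * n + 1\<bar> - 1"
  then have "nat \<bar>3 * m + 1\<bar> = nat \<bar>3 * n + 1\<bar>" using Suc_nat_abs_linear by metis
  then have "\<bar>3 * m + 1\<bar> = \<bar>3 * n + 1\<bar>" by simp
  then have "3 * m + 1 = 3 * n + 1 \<or> 3 * m + 1 = - (3 * n + 1)" by (simp only: abs_eq_iff)
  then show "m = n" by presburger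
qed

text \<open>N = 3k + 1 comes from m = k, and N = 3k + 2 from m = -k - 1.\<close>

lemma in_range_nat_abs_linear:
  assumes "Suc n mod 3 \<noteq> 0"
  shows "n \<in> range (\<lambda>m::int. nat \<bar>3 * m + 1\<bar> - 1)"
proof -
  define k where "k = n div 3"
  have "n = 3 * k \<or> n = 3 * k + 1" using assms unfolding k_def by presburger
  then show ?thesis
  proof
    assume n: "n = 3 * k"
    have "3 * int k + 1 = int (3 * k + 1)" by simp
    then have "nat \<bar>3 * int k + 1\<bar> - 1 = n" unfolding n by (simp only: abs_of_nat nat_int)
    then show ?thesis by blast
  next
    assume n: "n = 3 * k + 1"
    have "3 * (- int k - 1) + 1 = - int (3 * k + 2)" by simp
    then have "nat \<bar>3 * (- int k - 1) + 1\<bar> - 1 = n"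
      unfolding n by (simp only: abs_minus_cancel abs_of_nat nat_int)
    then show ?thesis by blast
  qed
qed

lemma in_range_nat_abs_linear_odd:
  assumes "Suc n mod 3 \<noteq> 0" "odd (Suc n)"
  shows "n \<in> range (\<lambda>m::int. nat \<bar>3 * (2 * m) + 1\<bar> - 1)"
proof -
  obtain m :: int where m: "n = nat \<bar>3 * m + 1\<bar> - 1" using in_range_nat_abs_linear[OF assms(1)] by blast
  then have "Suc n = nat \<bar>3 * m + 1\<bar>" using Suc_nat_abs_linear by simp
  then have "odd (3 * m + 1)" using assms(2) by (simp add: even_nat_iff)
  then obtain k where "m = 2 * k" by auto
  then show ?thesis using m by blast
qed

theorem theorem2p2:
  fixes \<tau> q :: complex
  assumes "Im \<tau> > 0" and "q = exp (2 * of_real pi * \<i> * \<tau>)"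
  shows
    "((\<lambda>n. of_int (kronecker (-4) (Suc n)) * of_nat (Suc n) * q ^ (Suc n)\<^sup>2) sums
        (dedekind_eta (8 * \<tau>) ^ 3)) \<and>
     ((\<lambda>n. of_int (kronecker (-2) (Suc n)) * of_nat (Suc n) * q ^ (Suc n)\<^sup>2) sums
        (dedekind_eta (16 * \<tau>) ^ 9 / (dedekind_eta (8 * \<tau>) ^ 3 * dedekind_eta (32 * \<tau>) ^ 3))) \<and>
     ((\<lambda>n. of_int (kronecker (int (Suc n)) 3) * of_nat (Suc n) * q ^ (Suc n)\<^sup>2) sums
        (dedekind_eta (3 * \<tau>) ^ 2 * dedekind_eta (12 * \<tau>) ^ 2 / dedekind_eta (6 * \<tau>))) \<and>
     ((\<lambda>n. of_int (kronecker (-6) (Suc n)) * of_nat (Suc n) * q ^ (Suc n)\<^sup>2) sums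
        (dedekind_eta (48 * \<tau>) ^ 13 / (dedekind_eta (24 * \<tau>) ^ 5 * dedekind_eta (96 * \<tau>) ^ 5))) \<and>
     ((\<lambda>n. of_int (kronecker (int (Suc n)) 12) * of_nat (Suc n) * q ^ (Suc n)\<^sup>2) sums
        (dedekind_eta (24 * \<tau>) ^ 5 / dedekind_eta (48 * \<tau>) ^ 2))"
proof -
  \<comment> \<open>The root q^(1/24) fixed by eta; every eta quotient becomes a power of
    \<open>u\<close> times Euler products.\<close>
  define u where "u = exp (2 * of_real pi * \<i> * \<tau> / 24)"
  have u: "u \<noteq> 0" by (simp add: u_def)
  have q_u: "q = u ^ 24"
    using exp_of_nat_mult[of 24 "2 * of_real pi * \<i> * \<tau> / 24"] by (simp add: u_def assms(2) mult_ac)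
  have q: "norm q < 1" "q \<noteq> 0"
    using assms(1) by (simp_all add: assms(2))
  have norm_qpow: "norm (q ^ n) < 1" if "n > 0" for n
    using norm_power_less_one[OF q(1) that] .
  have eta: "dedekind_eta (numeral w * \<tau>) = u ^ numeral w * euler_prod (q ^ numeral w)" for w
    unfolding dedekind_eta_mult u_def assms(2) ..
  have nz: "euler_prod (q ^ n) \<noteq> 0" if "n > 0" for n
    by (rule euler_prod_nz[OF norm_qpow[OF that]])
  have minus: "euler_prod (- (q ^ n)) = euler_prod (q ^ (2 * n)) ^ 3 / (euler_prod (q ^ n) * euler_prod (q ^ (4 * n)))"
    if "n > 0" for n
    using euler_prod_minus[OF norm_qpow[OF that]] by (simp add: power_mult[symmetric] mult.commute)
  have minus_powi: "(- z) powi e = (-1) powi e * z powi e" for z :: complex and e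
    using power_int_mult_distrib[of "-1" z e] by simp
  \<comment> \<open>Exponents for (4): 15 - 2 = 13 for the Euler product at q^48, and 48 * 13 = 624
    against 24 + (24 + 96) * 5 for \<open>u\<close>.\<close>
  have pow: "a ^ 15 = a ^ 13 * a\<^sup>2" "a ^ 624 = a ^ 24 * a ^ 600" for a :: complex
    by (simp_all flip: power_add)
  have int_mod_3: "int N mod 3 = 0" if "N mod 3 = 0" for N
    using zmod_int[of N 3] that by simp
  \<comment> \<open>The series are indexed by n with summation variable \<open>Suc n\<close>, hence
    the subtraction of 1.\<close>
  let ?h3 = "\<lambda>m::int. nat \<bar>3 * m + 1\<bar> - 1" and ?h6 = "\<lambda>m::int. nat \<bar>3 * (2 * m) + 1\<bar> - 1"
  have inj6: "inj ?h6"
  proof (rule injI)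
    fix m n assume "?h6 m = ?h6 n"
    then have "2 * m = 2 * n" by (rule injD[OF inj_nat_abs_linear])
    then show "m = n" by simp
  qed
  have N6: "Suc (?h6 m) = nat \<bar>6 * m + 1\<bar>" for m using Suc_nat_abs_linear[of "2 * m"] by simp
  have sq6: "q * (q ^ 24) powi (3 * tri m - m) = q ^ (nat \<bar>6 * m + 1\<bar>)\<^sup>2" for m
  proof (rule q_powi_complete_square[OF q(2)])
    show "1 + int 24 * (3 * tri m - m) = (int (nat \<bar>6 * m + 1\<bar>))\<^sup>2"
      using two_tri[of m] by (simp add: power2_eq_square algebra_simps)
  qed
  have sq2: "q * (q ^ 8) powi tri (int m) = q ^ (2 * m + 1)\<^sup>2" for m
  proof (rule q_powi_complete_square[OF q(2)])
    show "1 + int 8 * tri (int m) = (int (2 * m + 1))\<^sup>2"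
      using two_tri[of "int m"] by (simp add: power2_eq_square algebra_simps)
  qed

  have 1: "(\<lambda>n. of_int (kronecker (-4) (Suc n)) * of_nat (Suc n) * q ^ (Suc n)\<^sup>2) sums (dedekind_eta (8 * \<tau>) ^ 3)"
  proof (rule sums_reindex)
    have "((\<lambda>m::nat. q * ((-1) ^ m * of_nat (2 * m + 1) * (q ^ 8) powi tri (int m))) has_sum q * euler_prod (q ^ 8) ^ 3) UNIV"
      unfolding powi_tri_of_nat using q norm_qpow by (intro has_sum_cmult_right jacobi_cube_nat) auto
    also have "q * euler_prod (q ^ 8) ^ 3 = dedekind_eta (8 * \<tau>) ^ 3"
      unfolding eta by (simp add: q_u power_mult_distrib flip: power_mult)
    finally show "((\<lambda>m::nat. q * ((-1) ^ m * of_nat (2 * m + 1) * (q ^ 8) powi tri (int m))) has_sum dedekind_eta (8 * \<tau>) ^ 3) UNIV" .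
    show "inj (\<lambda>m::nat. 2 * m)" by (simp add: inj_def)
  next
    fix m :: nat
    have "chi_m4 (2 * m + 1) = (-1) ^ m"
    proof -
      have "(2 * m + 1) mod 4 = 1 \<longleftrightarrow> even m" by presburger
      then show ?thesis by (simp add: chi_m4_def minus_one_power_iff)
    qed
    then have "of_int (kronecker (-4) (2 * m + 1)) = (-1 :: complex) ^ m" by (simp add: kronecker_minus_4)
    then show "of_int (kronecker (-4) (Suc (2 * m))) * of_nat (Suc (2 * m)) * q ^ (Suc (2 * m))\<^sup>2
        = q * ((-1) ^ m * of_nat (2 * m + 1) * (q ^ 8) powi tri (int m))"
      using sq2[of m] by (simp add: mult_ac)
  next
    fix n :: nat assume "n \<notin> range (\<lambda>m. 2 * m)"
    then have "odd n" by (auto elim: evenE)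
    then show "of_int (kronecker (-4) (Suc n)) * of_nat (Suc n) * q ^ (Suc n)\<^sup>2 = 0"
      by (simp add: kronecker_minus_4 chi_m4_def)
  qed

  have 2: "(\<lambda>n. of_int (kronecker (-2) (Suc n)) * of_nat (Suc n) * q ^ (Suc n)\<^sup>2) sums
      (dedekind_eta (16 * \<tau>) ^ 9 / (dedekind_eta (8 * \<tau>) ^ 3 * dedekind_eta (32 * \<tau>) ^ 3))"
    (is "_ sums ?S")
  proof (rule sums_reindex)
    \<comment> \<open>Jacobi's cube at -(q^8); the minus sign changes \<open>chi_m4\<close> to
      \<open>chi_m8\<close> on the coefficients.\<close>
    have "((\<lambda>m::nat. q * ((-1) ^ m * of_nat (2 * m + 1) * (- (q ^ 8)) powi tri (int m))) has_sum q * euler_prod (- (q ^ 8)) ^ 3) UNIV"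
      unfolding powi_tri_of_nat using q norm_qpow by (intro has_sum_cmult_right jacobi_cube_nat) auto
    also have "q * euler_prod (- (q ^ 8)) ^ 3 = ?S"
      unfolding eta minus[of 8, simplified] using u nz[of 8] nz[of 16] nz[of 32]
      by (simp add: q_u power_mult_distrib power_divide divide_simps flip: power_mult power_add)
    finally show "((\<lambda>m::nat. q * ((-1) ^ m * of_nat (2 * m + 1) * (- (q ^ 8)) powi tri (int m))) has_sum ?S) UNIV" .
    show "inj (\<lambda>m::nat. 2 * m)" by (simp add: inj_def)
  next
    fix m :: nat
    have "of_int (kronecker (-2) (2 * m + 1)) = (-1 :: complex) ^ m * (-1) powi tri (int m)"
      using chi_m8_odd[of m] by (simp add: kronecker_minus_2)
    then show "of_int (kronecker (-2) (Suc (2 * m))) * of_nat (Suc (2 * m)) * q ^ (Suc (2 * m))\<^sup>2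
        = q * ((-1) ^ m * of_nat (2 * m + 1) * (- (q ^ 8)) powi tri (int m))"
      using sq2[of m] by (simp add: mult_ac minus_powi[of "q ^ 8"])
  next
    fix n :: nat assume "n \<notin> range (\<lambda>m. 2 * m)"
    then have "odd n" by (auto elim: evenE)
    then show "of_int (kronecker (-2) (Suc n)) * of_nat (Suc n) * q ^ (Suc n)\<^sup>2 = 0"
      by (simp add: kronecker_minus_2 chi_m8_def)
  qed

  have 3: "(\<lambda>n. of_int (kronecker (int (Suc n)) 3) * of_nat (Suc n) * q ^ (Suc n)\<^sup>2) sums
      (dedekind_eta (3 * \<tau>) ^ 2 * dedekind_eta (12 * \<tau>) ^ 2 / dedekind_eta (6 * \<tau>))"
    (is "_ sums ?S")
  proof (rule sums_reindex)
    have "((\<lambda>m::int. q * (of_int (3 * m + 1) * (q ^ 3) powi (3 * m\<^sup>2 + 2 * m))) has_sum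
        q * (euler_prod (q ^ 3) ^ 2 * euler_prod ((q ^ 3) ^ 4) ^ 2 / euler_prod ((q ^ 3)\<^sup>2))) UNIV"
      using q norm_qpow by (intro has_sum_cmult_right sum_linear_octagonal) auto
    also have "q * (euler_prod (q ^ 3) ^ 2 * euler_prod ((q ^ 3) ^ 4) ^ 2 / euler_prod ((q ^ 3)\<^sup>2)) = ?S"
      unfolding eta using u nz[of 6]
      by (simp add: q_u power_mult_distrib divide_simps flip: power_mult power_add)
    finally show "((\<lambda>m::int. q * (of_int (3 * m + 1) * (q ^ 3) powi (3 * m\<^sup>2 + 2 * m))) has_sum ?S) UNIV" .
    show "inj ?h3" by (rule inj_nat_abs_linear)
  next
    fix m :: int
    have e: "q * (q ^ 3) powi (3 * m\<^sup>2 + 2 * m) = q ^ (nat \<bar>3 * m + 1\<bar>)\<^sup>2"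
      by (rule q_powi_complete_square[OF q(2)]) (simp add: power2_eq_square algebra_simps)
    show "of_int (kronecker (int (Suc (?h3 m))) 3) * of_nat (Suc (?h3 m)) * q ^ (Suc (?h3 m))\<^sup>2
        = q * (of_int (3 * m + 1) * (q ^ 3) powi (3 * m\<^sup>2 + 2 * m))"
      unfolding Suc_nat_abs_linear kronecker_3_abs e[symmetric] by (simp only: mult_ac)
  next
    fix n :: nat assume "n \<notin> range ?h3"
    then have "Suc n mod 3 = 0" using in_range_nat_abs_linear by blast
    then have "int (Suc n) mod 3 = 0" by (rule int_mod_3)
    then show "of_int (kronecker (int (Suc n)) 3) * of_nat (Suc n) * q ^ (Suc n)\<^sup>2 = 0"
      unfolding kronecker_3 by simp
  qed

  have 4: "(\<lambda>n. of_int (kronecker (-6) (Suc n)) * of_nat (Suc n) * q ^ (Suc n)\<^sup>2) sums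
      (dedekind_eta (48 * \<tau>) ^ 13 / (dedekind_eta (24 * \<tau>) ^ 5 * dedekind_eta (96 * \<tau>) ^ 5))"
    (is "_ sums ?S")
  proof (rule sums_reindex)
    \<comment> \<open>The series of (5) with q^24 replaced by -(q^24), which changes the Euler
      products through \<open>minus\<close>.\<close>
    have "((\<lambda>m::int. q * (of_int (6 * m + 1) * (- (q ^ 24)) powi (3 * tri m - m))) has_sum
        q * (euler_prod (- (q ^ 24)) ^ 5 / euler_prod ((- (q ^ 24))\<^sup>2) ^ 2)) UNIV"
      using q norm_qpow by (intro has_sum_cmult_right sum_linear_pentagonal) auto
    also have "q * (euler_prod (- (q ^ 24)) ^ 5 / euler_prod ((- (q ^ 24))\<^sup>2) ^ 2) = ?S"
      unfolding eta minus[of 24, simplified] using u nz[of 24] nz[of 48] nz[of 96]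
      by (simp add: q_u power_mult_distrib power_divide divide_simps flip: power_mult power_add)
         (simp only: pow mult_ac)
    finally show "((\<lambda>m::int. q * (of_int (6 * m + 1) * (- (q ^ 24)) powi (3 * tri m - m))) has_sum ?S) UNIV" .
    show "inj ?h6" by (rule inj6)
  next
    fix m :: int
    have pos: "nat \<bar>6 * m + 1\<bar> > 0" by (metis N6 zero_less_Suc)
    have "of_int (kronecker (-6) (nat \<bar>6 * m + 1\<bar>)) * of_nat (nat \<bar>6 * m + 1\<bar>)
        = of_int (6 * m + 1) * (-1 :: complex) powi (3 * tri m - m)"
      unfolding kronecker_minus_6[OF pos] by (rule chi_24_pentagonal)
    then show "of_int (kronecker (-6) (Suc (?h6 m))) * of_nat (Suc (?h6 m)) * q ^ (Suc (?h6 m))\<^sup>2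
        = q * (of_int (6 * m + 1) * (- (q ^ 24)) powi (3 * tri m - m))"
      unfolding N6 minus_powi[of "q ^ 24"] sq6[symmetric] by (simp only: mult_ac)
  next
    fix n :: nat assume "n \<notin> range ?h6"
    then have "Suc n mod 3 = 0 \<or> even (Suc n)" using in_range_nat_abs_linear_odd by blast
    then show "of_int (kronecker (-6) (Suc n)) * of_nat (Suc n) * q ^ (Suc n)\<^sup>2 = 0"
      by (subst kronecker_minus_6) (auto simp: chi_m8_def chi_12_def)
  qed

  have 5: "(\<lambda>n. of_int (kronecker (int (Suc n)) 12) * of_nat (Suc n) * q ^ (Suc n)\<^sup>2) sums
      (dedekind_eta (24 * \<tau>) ^ 5 / dedekind_eta (48 * \<tau>) ^ 2)"
    (is "_ sums ?S")
  proof (rule sums_reindex)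
    have "((\<lambda>m::int. q * (of_int (6 * m + 1) * (q ^ 24) powi (3 * tri m - m))) has_sum
        q * (euler_prod (q ^ 24) ^ 5 / euler_prod ((q ^ 24)\<^sup>2) ^ 2)) UNIV"
      using q norm_qpow by (intro has_sum_cmult_right sum_linear_pentagonal) auto
    also have "q * (euler_prod (q ^ 24) ^ 5 / euler_prod ((q ^ 24)\<^sup>2) ^ 2) = ?S"
      unfolding eta using u nz[of 48]
      by (simp add: q_u power_mult_distrib divide_simps flip: power_mult power_add)
    finally show "((\<lambda>m::int. q * (of_int (6 * m + 1) * (q ^ 24) powi (3 * tri m - m))) has_sum ?S) UNIV" .
    show "inj ?h6" by (rule inj6)
  next
    fix m :: int
    \<comment> \<open>For odd arguments the symbol modulo 12 reduces to the one modulo 3, and 6m + 1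
      = 3(2m) + 1.\<close>
    have "odd (int (nat \<bar>6 * m + 1\<bar>))" by simp
    then have k: "of_int (kronecker (int (nat \<bar>6 * m + 1\<bar>)) 12) * of_nat (nat \<bar>6 * m + 1\<bar>) = (of_int (6 * m + 1) :: complex)"
      using kronecker_3_abs[of "2 * m"] by (simp add: kronecker_12)
    show "of_int (kronecker (int (Suc (?h6 m))) 12) * of_nat (Suc (?h6 m)) * q ^ (Suc (?h6 m))\<^sup>2
        = q * (of_int (6 * m + 1) * (q ^ 24) powi (3 * tri m - m))"
      unfolding N6 k sq6[symmetric] by (simp only: mult_ac)
  next
    fix n :: nat assume "n \<notin> range ?h6"
    then have "Suc n mod 3 = 0 \<or> even (Suc n)" using in_range_nat_abs_linear_odd by blast
    then have "int (Suc n) mod 3 = 0 \<or> even (int (Suc n))" using int_mod_3[of "Suc n"] by auto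
    then show "of_int (kronecker (int (Suc n)) 12) * of_nat (Suc n) * q ^ (Suc n)\<^sup>2 = 0"
      unfolding kronecker_12 kronecker_3 by auto
  qed

  from 1 2 3 4 5 show ?thesis by blast
qed

end
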